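(* Let $p:\mathcal{A}\to\mathcal{X}$ be a Fell bundle over a locally compact Hausdorff groupoid, and let $H$ be a locally compact group. Suppose $H$ acts freely and properly by automorphisms on the right of $\mathcal{A}$ (by which we mean that the associated action of $H$ on the groupoid $\mathcal{X}$ has these properties). Then the orbit space $\mathcal{A}/H$ becomes a Fell bundle over the orbit groupoid $\mathcal{X}/H$, with operations (i) $p(a\cdot H)=p(a)\cdot H$; (ii) $(a\cdot H)(b\cdot H)=(ab)\cdot H$ if $s(a)=r(b)$; (iii) $(a\cdot H)^*=a^*\cdot H$.
   Context: Conventions. All spaces, groups and groupoids are locally compact, Hausdorff and second countable; the given groupoid carries a left Haar system (so $r,s$ are continuous and open). Banach bundles. A (upper semicontinuous) Banach bundle is a continuous open surjection whose fibres are complex Banach spaces, such that the norm is upper semicontinuous on the total space, addition and scalar multiplication are continuous, and any net whose base points converge to $\omega$ and whose norms tend to $0$ converges to $0_\omega$. Bundles are separable: the Banach space of continuous sections vanishing at infinity is separable. Fell bundles. A Fell bundle $p:\mathcal{A}\to\mathcal{X}$ is a separable Banach bundle with a continuous associative multiplication $(a,b)\mapsto ab$ defined when $s(p(a))=r(p(b))$, bilinear on fibres with $p(ab)=p(a)p(b)$, and a continuous conjugate-linear involution with $p(a^* )=p(a)^{-1}$, $(ab)^*=b^*a^*$, $a^{**}=a$, such that each fibre $A(u)$, $u\in\mathcal{X}^{(0)}$, is a $C^*$-algebra and each fibre $A(x)$ is an $A(r(x))$–$A(s(x))$ imprimitivity bimodule under multiplication with inner products $ab^*$ and $a^*b$.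 Write $s(a)=s(p(a))$, $r(a)=r(p(a))$. Group actions. A right action of $H$ on $\mathcal{X}$ by automorphisms is a continuous map $(x,h)\mapsto x\cdot h$ with each $x\mapsto x\cdot h$ a groupoid automorphism and $(x\cdot h)\cdot k=x\cdot(hk)$. A right action of $H$ on $\mathcal{A}$ by automorphisms consists of such an action on $\mathcal{X}$ together with a continuous map $\mathcal{A}\times H\to\mathcal{A}$ with each $a\mapsto a\cdot h$ a Fell bundle automorphism (fibrewise linear isometric, preserving product and involution, covering $x\mapsto x\cdot h$) and $(a\cdot h)\cdot k=a\cdot(hk)$. The orbit groupoid $\mathcal{X}/H$ has the quotient topology and multiplication $(x\cdot H)(y\cdot H)=(xy)\cdot H$ whenever the representatives satisfy $s(x)=r(y)$. The fibre of $\mathcal{A}/H$ (quotient topology) over $x\cdot H$ is $p^{-1}(x)\cdot H$, with the linear structure transported from $p^{-1}(x)$ via $a\mapsto a\cdot H$ and norm $\|a\cdot H\|=\|a\|$. *)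

theory Defs
  imports "HOL-Analysis.Analysis" "HOL-Algebra.Group_Action"
begin

section \<open>Locally compact groups and groupoids\<close>

text \<open>Standing convention: groups, groupoids and base spaces of bundles are locally compact,
  Hausdorff and second countable.  (Total spaces of bundles are not covered by it: they are
  locally compact only if the fibres are finite dimensional.)\<close>

definition lchs_space :: "'x topology \<Rightarrow> bool" where
  "lchs_space T \<longleftrightarrow> locally_compact_space T \<and> Hausdorff_space T \<and> second_countable T"

locale lc_group = group H for H (structure) +
  fixes T :: "'h topology"
  assumes topspace_eq: "topspace T = carrier H"
    and lchs: "lchs_space T"
    and continuous_mult: "continuous_map (prod_topology T T) T (\<lambda>(h, k). h \<otimes> k)"
    and continuous_inv: "continuous_map T T (\<lambda>h. inv h)"

text \<open>Units are identified with the identity arrows; \<open>gmult X x y\<close> is meaningful only when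
  \<open>src X x = rng X y\<close>.\<close>

record 'x groupoid_data =
  gtop :: "'x topology"
  rng :: "'x \<Rightarrow> 'x"
  src :: "'x \<Rightarrow> 'x"
  gmult :: "'x \<Rightarrow> 'x \<Rightarrow> 'x"
  ginv :: "'x \<Rightarrow> 'x"

abbreviation arrows :: "('x, 'm) groupoid_data_scheme \<Rightarrow> 'x set" where
  "arrows X \<equiv> topspace (gtop X)"

definition units :: "('x, 'm) groupoid_data_scheme \<Rightarrow> 'x set" where
  "units X = rng X ` arrows X"

locale lc_groupoid =
  fixes X :: "('x, 'm) groupoid_data_scheme"
  assumes lchs: "lchs_space (gtop X)"
    and rng_closed: "x \<in> arrows X \<Longrightarrow> rng X x \<in> arrows X"
    and src_closed: "x \<in> arrows X \<Longrightarrow> src X x \<in> arrows X"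
    and rng_rng: "x \<in> arrows X \<Longrightarrow> rng X (rng X x) = rng X x"
    and src_rng: "x \<in> arrows X \<Longrightarrow> src X (rng X x) = rng X x"
    and rng_src: "x \<in> arrows X \<Longrightarrow> rng X (src X x) = src X x"
    and src_src: "x \<in> arrows X \<Longrightarrow> src X (src X x) = src X x"
    and gmult_closed: "\<lbrakk>x \<in> arrows X; y \<in> arrows X; src X x = rng X y\<rbrakk>
          \<Longrightarrow> gmult X x y \<in> arrows X"
    and rng_gmult: "\<lbrakk>x \<in> arrows X; y \<in> arrows X; src X x = rng X y\<rbrakk>
          \<Longrightarrow> rng X (gmult X x y) = rng X x"
    and src_gmult: "\<lbrakk>x \<in> arrows X; y \<in> arrows X; src X x = rng X y\<rbrakk>
          \<Longrightarrow> src X (gmult X x y) = src X y"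
    and gmult_assoc: "\<lbrakk>x \<in> arrows X; y \<in> arrows X; z \<in> arrows X;
            src X x = rng X y; src X y = rng X z\<rbrakk>
          \<Longrightarrow> gmult X (gmult X x y) z = gmult X x (gmult X y z)"
    and rng_gmult_left: "x \<in> arrows X \<Longrightarrow> gmult X (rng X x) x = x"
    and src_gmult_right: "x \<in> arrows X \<Longrightarrow> gmult X x (src X x) = x"
    and ginv_closed: "x \<in> arrows X \<Longrightarrow> ginv X x \<in> arrows X"
    and rng_ginv: "x \<in> arrows X \<Longrightarrow> rng X (ginv X x) = src X x"
    and src_ginv: "x \<in> arrows X \<Longrightarrow> src X (ginv X x) = rng X x"
    and gmult_ginv_right: "x \<in> arrows X \<Longrightarrow> gmult X x (ginv X x) = rng X x"
    and gmult_ginv_left: "x \<in> arrows X \<Longrightarrow> gmult X (ginv X x) x = src X x"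
    and continuous_gmult:
      "continuous_map (subtopology (prod_topology (gtop X) (gtop X)) {(x, y). src X x = rng X y})
         (gtop X) (\<lambda>(x, y). gmult X x y)"
    and continuous_ginv: "continuous_map (gtop X) (gtop X) (ginv X)"

text \<open>A left Haar system: Radon measures \<open>\<lambda>\<^sup>u\<close> with support \<open>r\<^sup>-\<^sup>1(u)\<close>, continuous in \<open>u\<close> and left
  invariant.  On a second countable locally compact Hausdorff space a Radon measure is just a Borel
  measure that is finite on compact sets.\<close>

definition borel_alg :: "'x topology \<Rightarrow> 'x measure" where
  "borel_alg T = sigma (topspace T) {U. openin T U}"

definition msupport :: "'x topology \<Rightarrow> 'x measure \<Rightarrow> 'x set" where
  "msupport T M = {x \<in> topspace T. \<forall>U. openin T U \<and> x \<in> U \<longrightarrow> emeasure M U > 0}"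

definition Cc_space :: "'x topology \<Rightarrow> ('x \<Rightarrow> complex) set" where
  "Cc_space T = {f. continuous_map T euclidean f \<and>
                    compactin T (T closure_of {x \<in> topspace T. f x \<noteq> 0})}"

definition left_haar_system ::
    "('x, 'm) groupoid_data_scheme \<Rightarrow> ('x \<Rightarrow> 'x measure) \<Rightarrow> bool" where
  "left_haar_system X l \<longleftrightarrow>
     (\<forall>u \<in> units X. sets (l u) = sets (borel_alg (gtop X)) \<and>
        (\<forall>K. compactin (gtop X) K \<longrightarrow> emeasure (l u) K < \<infinity>) \<and>
        msupport (gtop X) (l u) = {x \<in> arrows X. rng X x = u}) \<and>
     (\<forall>f \<in> Cc_space (gtop X).
        continuous_map (subtopology (gtop X) (units X)) euclidean
          (\<lambda>u. \<integral>x. f x \<partial>(l u))) \<and>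
     (\<forall>f \<in> Cc_space (gtop X). \<forall>x \<in> arrows X.
        set_lebesgue_integral (l (src X x)) {y \<in> arrows X. rng X y = src X x}
          (\<lambda>y. f (gmult X x y))
        = set_lebesgue_integral (l (rng X x)) {y \<in> arrows X. rng X y = rng X x} f)"


section \<open>Banach spaces, C*-algebras and imprimitivity bimodules on carrier sets\<close>

record 'e normed_data =
  vcarrier :: "'e set"
  vzero :: 'e
  vadd :: "'e \<Rightarrow> 'e \<Rightarrow> 'e"
  vscale :: "complex \<Rightarrow> 'e \<Rightarrow> 'e"
  vnorm :: "'e \<Rightarrow> real"

text \<open>The value off the carrier is irrelevant, but the locale \<open>Metric_space\<close> wants a
  distance that is nonnegative and symmetric everywhere.\<close>

definition vdist :: "('e, 'm) normed_data_scheme \<Rightarrow> 'e \<Rightarrow> 'e \<Rightarrow> real" where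
  "vdist E a b = (if a \<in> vcarrier E \<and> b \<in> vcarrier E
                  then vnorm E (vadd E a (vscale E (- 1) b)) else 0)"

locale complex_banach_space =
  fixes E :: "('e, 'm) normed_data_scheme"
  assumes zero_closed: "vzero E \<in> vcarrier E"
    and add_closed: "\<lbrakk>a \<in> vcarrier E; b \<in> vcarrier E\<rbrakk> \<Longrightarrow> vadd E a b \<in> vcarrier E"
    and scale_closed: "a \<in> vcarrier E \<Longrightarrow> vscale E c a \<in> vcarrier E"
    and add_assoc: "\<lbrakk>a \<in> vcarrier E; b \<in> vcarrier E; v \<in> vcarrier E\<rbrakk>
          \<Longrightarrow> vadd E (vadd E a b) v = vadd E a (vadd E b v)"
    and add_commute: "\<lbrakk>a \<in> vcarrier E; b \<in> vcarrier E\<rbrakk> \<Longrightarrow> vadd E a b = vadd E b a"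
    and zero_add: "a \<in> vcarrier E \<Longrightarrow> vadd E (vzero E) a = a"
    and add_inverse: "a \<in> vcarrier E \<Longrightarrow> \<exists>b \<in> vcarrier E. vadd E a b = vzero E"
    and scale_one: "a \<in> vcarrier E \<Longrightarrow> vscale E 1 a = a"
    and scale_scale: "a \<in> vcarrier E \<Longrightarrow> vscale E c (vscale E d a) = vscale E (c * d) a"
    and scale_add_right: "\<lbrakk>a \<in> vcarrier E; b \<in> vcarrier E\<rbrakk>
          \<Longrightarrow> vscale E c (vadd E a b) = vadd E (vscale E c a) (vscale E c b)"
    and scale_add_left: "a \<in> vcarrier E
          \<Longrightarrow> vscale E (c + d) a = vadd E (vscale E c a) (vscale E d a)"
    and norm_nonneg: "a \<in> vcarrier E \<Longrightarrow> vnorm E a \<ge> 0"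
    and norm_eq_0: "a \<in> vcarrier E \<Longrightarrow> vnorm E a = 0 \<longleftrightarrow> a = vzero E"
    and norm_scale: "a \<in> vcarrier E \<Longrightarrow> vnorm E (vscale E c a) = cmod c * vnorm E a"
    and norm_triangle: "\<lbrakk>a \<in> vcarrier E; b \<in> vcarrier E\<rbrakk>
          \<Longrightarrow> vnorm E (vadd E a b) \<le> vnorm E a + vnorm E b"
    and complete: "Metric_space.mcomplete (vcarrier E) (vdist E)"

definition csubspace_of :: "('e, 'm) normed_data_scheme \<Rightarrow> 'e set \<Rightarrow> bool" where
  "csubspace_of E V \<longleftrightarrow> V \<subseteq> vcarrier E \<and> vzero E \<in> V \<and>
     (\<forall>a \<in> V. \<forall>b \<in> V. vadd E a b \<in> V) \<and> (\<forall>c. \<forall>a \<in> V. vscale E c a \<in> V)"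

definition closed_span :: "('e, 'm) normed_data_scheme \<Rightarrow> 'e set \<Rightarrow> 'e set" where
  "closed_span E S = Metric_space.mtopology (vcarrier E) (vdist E) closure_of (csubspace_of E hull S)"

record 'a cstar_data = "'a normed_data" +
  vmult :: "'a \<Rightarrow> 'a \<Rightarrow> 'a"
  vstar :: "'a \<Rightarrow> 'a"

locale cstar_algebra = complex_banach_space A for A :: "('a, 'm) cstar_data_scheme" +
  assumes mult_closed: "\<lbrakk>a \<in> vcarrier A; b \<in> vcarrier A\<rbrakk> \<Longrightarrow> vmult A a b \<in> vcarrier A"
    and mult_assoc: "\<lbrakk>a \<in> vcarrier A; b \<in> vcarrier A; d \<in> vcarrier A\<rbrakk>
          \<Longrightarrow> vmult A (vmult A a b) d = vmult A a (vmult A b d)"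
    and mult_add_left: "\<lbrakk>a \<in> vcarrier A; b \<in> vcarrier A; d \<in> vcarrier A\<rbrakk>
          \<Longrightarrow> vmult A (vadd A a b) d = vadd A (vmult A a d) (vmult A b d)"
    and mult_add_right: "\<lbrakk>a \<in> vcarrier A; b \<in> vcarrier A; d \<in> vcarrier A\<rbrakk>
          \<Longrightarrow> vmult A a (vadd A b d) = vadd A (vmult A a b) (vmult A a d)"
    and mult_scale_left: "\<lbrakk>a \<in> vcarrier A; b \<in> vcarrier A\<rbrakk>
          \<Longrightarrow> vmult A (vscale A c a) b = vscale A c (vmult A a b)"
    and mult_scale_right: "\<lbrakk>a \<in> vcarrier A; b \<in> vcarrier A\<rbrakk>
          \<Longrightarrow> vmult A a (vscale A c b) = vscale A c (vmult A a b)"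
    and star_closed: "a \<in> vcarrier A \<Longrightarrow> vstar A a \<in> vcarrier A"
    and star_star: "a \<in> vcarrier A \<Longrightarrow> vstar A (vstar A a) = a"
    and star_add: "\<lbrakk>a \<in> vcarrier A; b \<in> vcarrier A\<rbrakk>
          \<Longrightarrow> vstar A (vadd A a b) = vadd A (vstar A a) (vstar A b)"
    and star_scale: "a \<in> vcarrier A \<Longrightarrow> vstar A (vscale A c a) = vscale A (cnj c) (vstar A a)"
    and star_mult: "\<lbrakk>a \<in> vcarrier A; b \<in> vcarrier A\<rbrakk>
          \<Longrightarrow> vstar A (vmult A a b) = vmult A (vstar A b) (vstar A a)"
    and norm_mult: "\<lbrakk>a \<in> vcarrier A; b \<in> vcarrier A\<rbrakk>
          \<Longrightarrow> vnorm A (vmult A a b) \<le> vnorm A a * vnorm A b"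
    and cstar_identity: "a \<in> vcarrier A \<Longrightarrow> vnorm A (vmult A (vstar A a) a) = (vnorm A a)\<^sup>2"

definition cstar_positive :: "('a, 'm) cstar_data_scheme \<Rightarrow> 'a \<Rightarrow> bool" where
  "cstar_positive A a \<longleftrightarrow> (\<exists>b \<in> vcarrier A. a = vmult A (vstar A b) b)"

text \<open>Full Hilbert modules.  The module is given as a Banach space and its norm is required to be
  the one defined by the inner product; definiteness of the inner product and completeness in the
  inner product norm are contained in this.\<close>

locale full_left_hilbert_module =
  A: cstar_algebra A + E: complex_banach_space E
  for A :: "('a, 'm) cstar_data_scheme" and E :: "('e, 'n) normed_data_scheme" +
  fixes act :: "'a \<Rightarrow> 'e \<Rightarrow> 'e" and ip :: "'e \<Rightarrow> 'e \<Rightarrow> 'a"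
  assumes act_closed: "\<lbrakk>a \<in> vcarrier A; x \<in> vcarrier E\<rbrakk> \<Longrightarrow> act a x \<in> vcarrier E"
    and act_add_left: "\<lbrakk>a \<in> vcarrier A; b \<in> vcarrier A; x \<in> vcarrier E\<rbrakk>
          \<Longrightarrow> act (vadd A a b) x = vadd E (act a x) (act b x)"
    and act_add_right: "\<lbrakk>a \<in> vcarrier A; x \<in> vcarrier E; y \<in> vcarrier E\<rbrakk>
          \<Longrightarrow> act a (vadd E x y) = vadd E (act a x) (act a y)"
    and act_scale_left: "\<lbrakk>a \<in> vcarrier A; x \<in> vcarrier E\<rbrakk>
          \<Longrightarrow> act (vscale A c a) x = vscale E c (act a x)"
    and act_scale_right: "\<lbrakk>a \<in> vcarrier A; x \<in> vcarrier E\<rbrakk>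
          \<Longrightarrow> act a (vscale E c x) = vscale E c (act a x)"
    and act_mult: "\<lbrakk>a \<in> vcarrier A; b \<in> vcarrier A; x \<in> vcarrier E\<rbrakk>
          \<Longrightarrow> act (vmult A a b) x = act a (act b x)"
    and ip_closed: "\<lbrakk>x \<in> vcarrier E; y \<in> vcarrier E\<rbrakk> \<Longrightarrow> ip x y \<in> vcarrier A"
    and ip_add: "\<lbrakk>x \<in> vcarrier E; y \<in> vcarrier E; z \<in> vcarrier E\<rbrakk>
          \<Longrightarrow> ip (vadd E x y) z = vadd A (ip x z) (ip y z)"
    and ip_scale: "\<lbrakk>x \<in> vcarrier E; y \<in> vcarrier E\<rbrakk>
          \<Longrightarrow> ip (vscale E c x) y = vscale A c (ip x y)"
    and ip_act: "\<lbrakk>a \<in> vcarrier A; x \<in> vcarrier E; y \<in> vcarrier E\<rbrakk>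
          \<Longrightarrow> ip (act a x) y = vmult A a (ip x y)"
    and ip_star: "\<lbrakk>x \<in> vcarrier E; y \<in> vcarrier E\<rbrakk> \<Longrightarrow> vstar A (ip x y) = ip y x"
    and ip_positive: "x \<in> vcarrier E \<Longrightarrow> cstar_positive A (ip x x)"
    and ip_norm: "x \<in> vcarrier E \<Longrightarrow> (vnorm E x)\<^sup>2 = vnorm A (ip x x)"
    and full: "closed_span A {ip x y | x y. x \<in> vcarrier E \<and> y \<in> vcarrier E} = vcarrier A"

locale full_right_hilbert_module =
  B: cstar_algebra B + E: complex_banach_space E
  for B :: "('b, 'm) cstar_data_scheme" and E :: "('e, 'n) normed_data_scheme" +
  fixes act :: "'e \<Rightarrow> 'b \<Rightarrow> 'e" and ip :: "'e \<Rightarrow> 'e \<Rightarrow> 'b"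
  assumes act_closed: "\<lbrakk>x \<in> vcarrier E; b \<in> vcarrier B\<rbrakk> \<Longrightarrow> act x b \<in> vcarrier E"
    and act_add_left: "\<lbrakk>x \<in> vcarrier E; y \<in> vcarrier E; b \<in> vcarrier B\<rbrakk>
          \<Longrightarrow> act (vadd E x y) b = vadd E (act x b) (act y b)"
    and act_add_right: "\<lbrakk>x \<in> vcarrier E; a \<in> vcarrier B; b \<in> vcarrier B\<rbrakk>
          \<Longrightarrow> act x (vadd B a b) = vadd E (act x a) (act x b)"
    and act_scale_left: "\<lbrakk>x \<in> vcarrier E; b \<in> vcarrier B\<rbrakk>
          \<Longrightarrow> act (vscale E c x) b = vscale E c (act x b)"
    and act_scale_right: "\<lbrakk>x \<in> vcarrier E; b \<in> vcarrier B\<rbrakk>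
          \<Longrightarrow> act x (vscale B c b) = vscale E c (act x b)"
    and act_mult: "\<lbrakk>x \<in> vcarrier E; a \<in> vcarrier B; b \<in> vcarrier B\<rbrakk>
          \<Longrightarrow> act x (vmult B a b) = act (act x a) b"
    and ip_closed: "\<lbrakk>x \<in> vcarrier E; y \<in> vcarrier E\<rbrakk> \<Longrightarrow> ip x y \<in> vcarrier B"
    and ip_add: "\<lbrakk>x \<in> vcarrier E; y \<in> vcarrier E; z \<in> vcarrier E\<rbrakk>
          \<Longrightarrow> ip x (vadd E y z) = vadd B (ip x y) (ip x z)"
    and ip_scale: "\<lbrakk>x \<in> vcarrier E; y \<in> vcarrier E\<rbrakk>
          \<Longrightarrow> ip x (vscale E c y) = vscale B c (ip x y)"
    and ip_act: "\<lbrakk>x \<in> vcarrier E; y \<in> vcarrier E; b \<in> vcarrier B\<rbrakk>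
          \<Longrightarrow> ip x (act y b) = vmult B (ip x y) b"
    and ip_star: "\<lbrakk>x \<in> vcarrier E; y \<in> vcarrier E\<rbrakk> \<Longrightarrow> vstar B (ip x y) = ip y x"
    and ip_positive: "x \<in> vcarrier E \<Longrightarrow> cstar_positive B (ip x x)"
    and ip_norm: "x \<in> vcarrier E \<Longrightarrow> (vnorm E x)\<^sup>2 = vnorm B (ip x x)"
    and full: "closed_span B {ip x y | x y. x \<in> vcarrier E \<and> y \<in> vcarrier E} = vcarrier B"

locale imprimitivity_bimodule =
  L: full_left_hilbert_module A E lact lip + R: full_right_hilbert_module B E ract rip
  for A :: "('a, 'm) cstar_data_scheme" and B :: "('b, 'n) cstar_data_scheme"
    and E :: "('e, 'k) normed_data_scheme"
    and lact :: "'a \<Rightarrow> 'e \<Rightarrow> 'e" and ract :: "'e \<Rightarrow> 'b \<Rightarrow> 'e"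
    and lip :: "'e \<Rightarrow> 'e \<Rightarrow> 'a" and rip :: "'e \<Rightarrow> 'e \<Rightarrow> 'b" +
  assumes bimodule: "\<lbrakk>a \<in> vcarrier A; x \<in> vcarrier E; b \<in> vcarrier B\<rbrakk>
          \<Longrightarrow> ract (lact a x) b = lact a (ract x b)"
    and left_adjointable: "\<lbrakk>a \<in> vcarrier A; x \<in> vcarrier E; y \<in> vcarrier E\<rbrakk>
          \<Longrightarrow> rip (lact a x) y = rip x (lact (vstar A a) y)"
    and right_adjointable: "\<lbrakk>b \<in> vcarrier B; x \<in> vcarrier E; y \<in> vcarrier E\<rbrakk>
          \<Longrightarrow> lip (ract x b) y = lip x (ract y (vstar B b))"
    and compatible: "\<lbrakk>x \<in> vcarrier E; y \<in> vcarrier E; z \<in> vcarrier E\<rbrakk>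
          \<Longrightarrow> lact (lip x y) z = ract x (rip y z)"


section \<open>Banach bundles and Fell bundles\<close>

text \<open>Addition is meaningful only within a fibre; \<open>bzero B x\<close> is the zero of the fibre over \<open>x\<close>.\<close>

record ('a, 'x) bundle_data =
  btop :: "'a topology"
  proj :: "'a \<Rightarrow> 'x"
  bzero :: "'x \<Rightarrow> 'a"
  badd :: "'a \<Rightarrow> 'a \<Rightarrow> 'a"
  bscale :: "complex \<Rightarrow> 'a \<Rightarrow> 'a"
  bnorm :: "'a \<Rightarrow> real"

definition fibre :: "('a, 'x, 'm) bundle_data_scheme \<Rightarrow> 'x \<Rightarrow> 'a normed_data" where
  "fibre B x = \<lparr>vcarrier = {a \<in> topspace (btop B). proj B a = x}, vzero = bzero B x,
                vadd = badd B, vscale = bscale B, vnorm = bnorm B\<rparr>"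

definition c0_sections :: "'x topology \<Rightarrow> ('a, 'x, 'm) bundle_data_scheme \<Rightarrow> ('x \<Rightarrow> 'a) set" where
  "c0_sections T B = {f. continuous_map T (btop B) f \<and> (\<forall>x \<in> topspace T. proj B (f x) = x) \<and>
     (\<forall>e > 0. compactin T {x \<in> topspace T. e \<le> bnorm B (f x)})}"

text \<open>Two encodings: nets in the total space are represented by the filters they generate; and
  separability of the Banach space of sections is density of a countable set for the supremum
  norm.\<close>

locale banach_bundle =
  fixes T :: "'x topology" and B :: "('a, 'x, 'm) bundle_data_scheme"
  assumes base_lchs: "lchs_space T"
    and continuous_proj: "continuous_map (btop B) T (proj B)"
    and open_proj: "open_map (btop B) T (proj B)"
    and surj_proj: "proj B ` topspace (btop B) = topspace T"
    and banach_fibre: "x \<in> topspace T \<Longrightarrow> complex_banach_space (fibre B x)"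
    and usc_norm: "openin (btop B) {a \<in> topspace (btop B). bnorm B a < c}"
    and continuous_add:
      "continuous_map (subtopology (prod_topology (btop B) (btop B)) {(a, b). proj B a = proj B b})
         (btop B) (\<lambda>(a, b). badd B a b)"
    and continuous_scale:
      "continuous_map (prod_topology euclidean (btop B)) (btop B) (\<lambda>(c, a). bscale B c a)"
    and net_to_zero:
      "\<lbrakk>\<forall>\<^sub>F a in F. a \<in> topspace (btop B); limitin T (proj B) x F; (bnorm B \<longlongrightarrow> 0) F\<rbrakk>
         \<Longrightarrow> limitin (btop B) (\<lambda>a. a) (bzero B x) F"
    and separable:
      "\<exists>D. countable D \<and> D \<subseteq> c0_sections T B \<and>
         (\<forall>f \<in> c0_sections T B. \<forall>e > 0. \<exists>g \<in> D. \<forall>x \<in> topspace T.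
            bnorm B (badd B (f x) (bscale B (- 1) (g x))) < e)"

record ('a, 'x) fell_data = "('a, 'x) bundle_data" +
  bmult :: "'a \<Rightarrow> 'a \<Rightarrow> 'a"
  bstar :: "'a \<Rightarrow> 'a"

definition fibre_alg :: "('a, 'x, 'm) fell_data_scheme \<Rightarrow> 'x \<Rightarrow> 'a cstar_data" where
  "fibre_alg A u = \<lparr>vcarrier = {a \<in> topspace (btop A). proj A a = u}, vzero = bzero A u,
                    vadd = badd A, vscale = bscale A, vnorm = bnorm A,
                    vmult = bmult A, vstar = bstar A\<rparr>"

definition bsrc :: "('x, 'n) groupoid_data_scheme \<Rightarrow> ('a, 'x, 'm) bundle_data_scheme \<Rightarrow> 'a \<Rightarrow> 'x"
  where "bsrc X A a = src X (proj A a)"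

definition brng :: "('x, 'n) groupoid_data_scheme \<Rightarrow> ('a, 'x, 'm) bundle_data_scheme \<Rightarrow> 'a \<Rightarrow> 'x"
  where "brng X A a = rng X (proj A a)"

locale fell_bundle = lc_groupoid X + banach_bundle "gtop X" A
  for X :: "('x, 'n) groupoid_data_scheme" and A :: "('a, 'x, 'm) fell_data_scheme" +
  assumes bmult_closed: "\<lbrakk>a \<in> topspace (btop A); b \<in> topspace (btop A); bsrc X A a = brng X A b\<rbrakk>
          \<Longrightarrow> bmult A a b \<in> topspace (btop A)"
    and proj_bmult: "\<lbrakk>a \<in> topspace (btop A); b \<in> topspace (btop A); bsrc X A a = brng X A b\<rbrakk>
          \<Longrightarrow> proj A (bmult A a b) = gmult X (proj A a) (proj A b)"
    and continuous_bmult: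
      "continuous_map
         (subtopology (prod_topology (btop A) (btop A)) {(a, b). bsrc X A a = brng X A b})
         (btop A) (\<lambda>(a, b). bmult A a b)"
    and bmult_assoc: "\<lbrakk>a \<in> topspace (btop A); b \<in> topspace (btop A); d \<in> topspace (btop A);
            bsrc X A a = brng X A b; bsrc X A b = brng X A d\<rbrakk>
          \<Longrightarrow> bmult A (bmult A a b) d = bmult A a (bmult A b d)"
    and bmult_add_left: "\<lbrakk>a \<in> topspace (btop A); a' \<in> topspace (btop A); b \<in> topspace (btop A);
            proj A a = proj A a'; bsrc X A a = brng X A b\<rbrakk>
          \<Longrightarrow> bmult A (badd A a a') b = badd A (bmult A a b) (bmult A a' b)"
    and bmult_add_right: "\<lbrakk>a \<in> topspace (btop A); b \<in> topspace (btop A); b' \<in> topspace (btop A);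
            proj A b = proj A b'; bsrc X A a = brng X A b\<rbrakk>
          \<Longrightarrow> bmult A a (badd A b b') = badd A (bmult A a b) (bmult A a b')"
    and bmult_scale_left: "\<lbrakk>a \<in> topspace (btop A); b \<in> topspace (btop A); bsrc X A a = brng X A b\<rbrakk>
          \<Longrightarrow> bmult A (bscale A c a) b = bscale A c (bmult A a b)"
    and bmult_scale_right: "\<lbrakk>a \<in> topspace (btop A); b \<in> topspace (btop A); bsrc X A a = brng X A b\<rbrakk>
          \<Longrightarrow> bmult A a (bscale A c b) = bscale A c (bmult A a b)"
    and bstar_closed: "a \<in> topspace (btop A) \<Longrightarrow> bstar A a \<in> topspace (btop A)"
    and proj_bstar: "a \<in> topspace (btop A) \<Longrightarrow> proj A (bstar A a) = ginv X (proj A a)"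
    and continuous_bstar: "continuous_map (btop A) (btop A) (bstar A)"
    and bstar_add: "\<lbrakk>a \<in> topspace (btop A); b \<in> topspace (btop A); proj A a = proj A b\<rbrakk>
          \<Longrightarrow> bstar A (badd A a b) = badd A (bstar A a) (bstar A b)"
    and bstar_scale: "a \<in> topspace (btop A)
          \<Longrightarrow> bstar A (bscale A c a) = bscale A (cnj c) (bstar A a)"
    and bstar_bmult: "\<lbrakk>a \<in> topspace (btop A); b \<in> topspace (btop A); bsrc X A a = brng X A b\<rbrakk>
          \<Longrightarrow> bstar A (bmult A a b) = bmult A (bstar A b) (bstar A a)"
    and bstar_bstar: "a \<in> topspace (btop A) \<Longrightarrow> bstar A (bstar A a) = a"
    and cstar_fibre: "u \<in> units X \<Longrightarrow> cstar_algebra (fibre_alg A u)"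
    and imprimitivity: "x \<in> arrows X \<Longrightarrow>
          imprimitivity_bimodule (fibre_alg A (rng X x)) (fibre_alg A (src X x)) (fibre A x)
            (bmult A) (bmult A) (\<lambda>a b. bmult A a (bstar A b)) (\<lambda>a b. bmult A (bstar A a) b)"


section \<open>Right actions by automorphisms\<close>

definition groupoid_automorphism :: "('x, 'n) groupoid_data_scheme \<Rightarrow> ('x \<Rightarrow> 'x) \<Rightarrow> bool" where
  "groupoid_automorphism X f \<longleftrightarrow> bij_betw f (arrows X) (arrows X) \<and>
     (\<forall>x \<in> arrows X. \<forall>y \<in> arrows X. src X x = rng X y \<longrightarrow>
        src X (f x) = rng X (f y) \<and> f (gmult X x y) = gmult X (f x) (f y))"

text \<open>\<open>f\<close> is a Fell bundle automorphism covering \<open>g\<close>.\<close>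

definition fell_automorphism ::
    "('x, 'n) groupoid_data_scheme \<Rightarrow> ('a, 'x, 'm) fell_data_scheme \<Rightarrow> ('x \<Rightarrow> 'x) \<Rightarrow> ('a \<Rightarrow> 'a) \<Rightarrow> bool"
  where
  "fell_automorphism X A g f \<longleftrightarrow> bij_betw f (topspace (btop A)) (topspace (btop A)) \<and>
     (\<forall>a \<in> topspace (btop A).
        proj A (f a) = g (proj A a) \<and>
        bnorm A (f a) = bnorm A a \<and>
        f (bstar A a) = bstar A (f a) \<and>
        (\<forall>c. f (bscale A c a) = bscale A c (f a)) \<and>
        (\<forall>b \<in> topspace (btop A). proj A a = proj A b \<longrightarrow> f (badd A a b) = badd A (f a) (f b)) \<and>
        (\<forall>b \<in> topspace (btop A). bsrc X A a = brng X A b \<longrightarrow> f (bmult A a b) = bmult A (f a) (f b)))"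

locale groupoid_action = lc_groupoid X + H: lc_group H TH
  for X :: "('x, 'n) groupoid_data_scheme" and H :: "('h, 'k) monoid_scheme" and TH +
  fixes act :: "'x \<Rightarrow> 'h \<Rightarrow> 'x"
  assumes continuous_act: "continuous_map (prod_topology (gtop X) TH) (gtop X) (\<lambda>(x, h). act x h)"
    and automorphism: "h \<in> carrier H \<Longrightarrow> groupoid_automorphism X (\<lambda>x. act x h)"
    and act_act: "\<lbrakk>x \<in> arrows X; h \<in> carrier H; k \<in> carrier H\<rbrakk>
          \<Longrightarrow> act (act x h) k = act x (h \<otimes>\<^bsub>H\<^esub> k)"

locale fell_bundle_action = groupoid_action X H TH act + fell_bundle X A
  for X :: "('x, 'n) groupoid_data_scheme" and A :: "('a, 'x, 'm) fell_data_scheme"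
    and H :: "('h, 'k) monoid_scheme" and TH and act :: "'x \<Rightarrow> 'h \<Rightarrow> 'x" +
  fixes bact :: "'a \<Rightarrow> 'h \<Rightarrow> 'a"
  assumes continuous_bact: "continuous_map (prod_topology (btop A) TH) (btop A) (\<lambda>(a, h). bact a h)"
    and bautomorphism: "h \<in> carrier H \<Longrightarrow> fell_automorphism X A (\<lambda>x. act x h) (\<lambda>a. bact a h)"
    and bact_bact: "\<lbrakk>a \<in> topspace (btop A); h \<in> carrier H; k \<in> carrier H\<rbrakk>
          \<Longrightarrow> bact (bact a h) k = bact a (h \<otimes>\<^bsub>H\<^esub> k)"

definition free_action :: "'x topology \<Rightarrow> ('h, 'k) monoid_scheme \<Rightarrow> ('x \<Rightarrow> 'h \<Rightarrow> 'x) \<Rightarrow> bool" where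
  "free_action T H act \<longleftrightarrow>
     (\<forall>x \<in> topspace T. \<forall>h \<in> carrier H. act x h = x \<longrightarrow> h = \<one>\<^bsub>H\<^esub>)"

definition proper_action :: "'x topology \<Rightarrow> 'h topology \<Rightarrow> ('x \<Rightarrow> 'h \<Rightarrow> 'x) \<Rightarrow> bool" where
  "proper_action T TH act \<longleftrightarrow>
     proper_map (prod_topology T TH) (prod_topology T T) (\<lambda>(x, h). (act x h, x))"


section \<open>Orbit groupoid and orbit bundle\<close>

definition rorbit :: "('h, 'k) monoid_scheme \<Rightarrow> ('x \<Rightarrow> 'h \<Rightarrow> 'x) \<Rightarrow> 'x \<Rightarrow> 'x set" where
  "rorbit H act x = orbit H (\<lambda>h x. act x h) x"

definition quotient_topology :: "'x topology \<Rightarrow> ('x \<Rightarrow> 'y) \<Rightarrow> 'y topology" where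
  "quotient_topology T q =
     topology (\<lambda>U. U \<subseteq> q ` topspace T \<and> openin T {x \<in> topspace T. q x \<in> U})"

text \<open>Structure maps on orbits are given by images of sets of representatives, so that no choices
  are involved; the lemmas below give their values on \<open>x\<cdot>H\<close>.\<close>

definition orbit_groupoid ::
    "('x, 'n) groupoid_data_scheme \<Rightarrow> ('h, 'k) monoid_scheme \<Rightarrow> ('x \<Rightarrow> 'h \<Rightarrow> 'x)
      \<Rightarrow> 'x set groupoid_data" where
  "orbit_groupoid X H act =
     \<lparr>gtop = quotient_topology (gtop X) (rorbit H act),
      rng = (\<lambda>P. rng X ` P),
      src = (\<lambda>P. src X ` P),
      gmult = (\<lambda>P Q. {gmult X x y | x y. x \<in> P \<and> y \<in> Q \<and> src X x = rng X y}),
      ginv = (\<lambda>P. ginv X ` P)\<rparr>"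

definition orbit_bundle ::
    "('x, 'n) groupoid_data_scheme \<Rightarrow> ('a, 'x, 'm) fell_data_scheme \<Rightarrow> ('h, 'k) monoid_scheme
      \<Rightarrow> ('a \<Rightarrow> 'h \<Rightarrow> 'a) \<Rightarrow> ('a set, 'x set) fell_data" where
  "orbit_bundle X A H bact =
     \<lparr>btop = quotient_topology (btop A) (rorbit H bact),
      proj = (\<lambda>P. proj A ` P),
      bzero = (\<lambda>P. bzero A ` P),
      badd = (\<lambda>P Q. {badd A a b | a b. a \<in> P \<and> b \<in> Q \<and> proj A a = proj A b}),
      bscale = (\<lambda>c P. bscale A c ` P),
      bnorm = (\<lambda>P. the_elem (bnorm A ` P)),
      bmult = (\<lambda>P Q. {bmult A a b | a b. a \<in> P \<and> b \<in> Q \<and> bsrc X A a = brng X A b}),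
      bstar = (\<lambda>P. bstar A ` P)\<rparr>"

lemma istopology_quotient:
  "istopology (\<lambda>U. U \<subseteq> q ` topspace T \<and> openin T {x \<in> topspace T. q x \<in> U})"
  unfolding istopology_def
proof (intro conjI allI impI)
  fix U V
  assume U: "U \<subseteq> q ` topspace T \<and> openin T {x \<in> topspace T. q x \<in> U}"
    and V: "V \<subseteq> q ` topspace T \<and> openin T {x \<in> topspace T. q x \<in> V}"
  show "U \<inter> V \<subseteq> q ` topspace T" using U by blast
  have "{x \<in> topspace T. q x \<in> U \<inter> V} = {x \<in> topspace T. q x \<in> U} \<inter> {x \<in> topspace T. q x \<in> V}"
    by blast
  then show "openin T {x \<in> topspace T. q x \<in> U \<inter> V}"
    using openin_Int[OF conjunct2[OF U] conjunct2[OF V]] by (rule ssubst)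
next
  fix \<K>
  assume K: "\<forall>K\<in>\<K>. K \<subseteq> q ` topspace T \<and> openin T {x \<in> topspace T. q x \<in> K}"
  show "\<Union>\<K> \<subseteq> q ` topspace T" using K by blast
  have "{x \<in> topspace T. q x \<in> \<Union>\<K>} = (\<Union>K\<in>\<K>. {x \<in> topspace T. q x \<in> K})"
    by blast
  moreover have "openin T (\<Union>K\<in>\<K>. {x \<in> topspace T. q x \<in> K})"
    using K by auto
  ultimately show "openin T {x \<in> topspace T. q x \<in> \<Union>\<K>}" by (rule ssubst)
qed

lemma openin_quotient_topology:
  "openin (quotient_topology T q) U \<longleftrightarrow>
     U \<subseteq> q ` topspace T \<and> openin T {x \<in> topspace T. q x \<in> U}"
  unfolding quotient_topology_def by (subst topology_inverse'[OF istopology_quotient]) (rule refl)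

lemma topspace_quotient_topology [simp]: "topspace (quotient_topology T q) = q ` topspace T"
proof
  show "topspace (quotient_topology T q) \<subseteq> q ` topspace T"
    by (metis openin_quotient_topology openin_topspace)
  have "{x \<in> topspace T. q x \<in> q ` topspace T} = topspace T"
    by auto
  then have "openin (quotient_topology T q) (q ` topspace T)"
    by (simp add: openin_quotient_topology)
  then show "q ` topspace T \<subseteq> topspace (quotient_topology T q)"
    by (rule openin_subset)
qed

lemma quotient_map_quotient_topology: "quotient_map T (quotient_topology T q) q"
  unfolding quotient_map_def openin_quotient_topology topspace_quotient_topology by blast

lemma rorbit_eq: "rorbit H act x = {act x h | h. h \<in> carrier H}"
  by (simp add: rorbit_def orbit_def)

context groupoid_action
begin

lemma act_closed: "\<lbrakk>x \<in> arrows X; h \<in> carrier H\<rbrakk> \<Longrightarrow> act x h \<in> arrows X"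
  using automorphism[of h] unfolding groupoid_automorphism_def by (auto dest: bij_betwE)

lemma act_gmult:
  assumes "x \<in> arrows X" "y \<in> arrows X" "src X x = rng X y" "h \<in> carrier H"
  shows "src X (act x h) = rng X (act y h)" "act (gmult X x y) h = gmult X (act x h) (act y h)"
  using automorphism[OF assms(4)] assms(1-3) unfolding groupoid_automorphism_def by blast+

lemma act_rng: assumes x: "x \<in> arrows X" and h: "h \<in> carrier H"
  shows "rng X (act x h) = act (rng X x) h"
proof -
  let ?u = "act (rng X x) h"
  have u: "rng X x \<in> arrows X" "src X (rng X x) = rng X x" "src X (rng X x) = rng X (rng X x)"
    using x by (simp_all add: rng_closed src_rng rng_rng)
  have ua: "?u \<in> arrows X" using u h act_closed by blast
  have c: "src X ?u = rng X (act x h)" using act_gmult[OF u(1) x u(2) h] by simp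
  have c2: "src X ?u = rng X ?u" using act_gmult[OF u(1) u(1) u(3) h] by simp
  have "gmult X (rng X x) (rng X x) = rng X x" using rng_gmult_left[OF u(1)] rng_rng[OF x] by simp
  then have i: "gmult X ?u ?u = ?u" using act_gmult[OF u(1) u(1) u(3) h] by simp
  have iv: "ginv X ?u \<in> arrows X" "src X (ginv X ?u) = rng X ?u"
    using ua by (simp_all add: ginv_closed src_ginv)
  have "gmult X (gmult X (ginv X ?u) ?u) ?u = gmult X (ginv X ?u) (gmult X ?u ?u)"
    using gmult_assoc[OF iv(1) ua ua iv(2) c2] .
  then have "gmult X (src X ?u) ?u = src X ?u"
    using i gmult_ginv_left[OF ua] by simp
  then have "?u = src X ?u" using c2 rng_gmult_left[OF ua] by simp
  then show ?thesis using c by simp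
qed

lemma act_src: assumes x: "x \<in> arrows X" and h: "h \<in> carrier H"
  shows "src X (act x h) = act (src X x) h"
proof -
  have "src X (act x h) = rng X (act (src X x) h)"
    using act_gmult(1)[OF x src_closed[OF x] rng_src[OF x, symmetric] h] .
  also have "\<dots> = act (rng X (src X x)) h" using act_rng[OF src_closed[OF x] h] .
  finally show ?thesis using rng_src[OF x] by simp
qed

lemma act_one: assumes "x \<in> arrows X" shows "act x \<one>\<^bsub>H\<^esub> = x"
proof -
  have "act (act x \<one>\<^bsub>H\<^esub>) \<one>\<^bsub>H\<^esub> = act x \<one>\<^bsub>H\<^esub>" using assms act_act by simp
  moreover have "inj_on (\<lambda>x. act x \<one>\<^bsub>H\<^esub>) (arrows X)"
    using automorphism[of "\<one>\<^bsub>H\<^esub>"] unfolding groupoid_automorphism_def by (auto dest: bij_betw_imp_inj_on)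
  ultimately show ?thesis using assms act_closed[of x "\<one>\<^bsub>H\<^esub>"] by (auto dest: inj_onD)
qed

lemma free_eq:
  assumes "free_action (gtop X) H act" "x \<in> arrows X" "h \<in> carrier H" "k \<in> carrier H"
    and "act x h = act x k"
  shows "h = k"
proof -
  have "act x (h \<otimes>\<^bsub>H\<^esub> inv\<^bsub>H\<^esub> k) = act (act x k) (inv\<^bsub>H\<^esub> k)"
    using assms act_act[of x h "inv\<^bsub>H\<^esub> k"] by simp
  also have "\<dots> = x" using assms act_act[of x k "inv\<^bsub>H\<^esub> k"] act_one by simp
  finally have "h \<otimes>\<^bsub>H\<^esub> inv\<^bsub>H\<^esub> k = \<one>\<^bsub>H\<^esub>"
    using assms unfolding free_action_def by simp
  then show ?thesis using assms H.inv_equality[of h "inv\<^bsub>H\<^esub> k"] by simp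
qed

lemma orbit_groupoid_rng:
  "x \<in> arrows X \<Longrightarrow> rng (orbit_groupoid X H act) (rorbit H act x) = rorbit H act (rng X x)"
  unfolding orbit_groupoid_def rorbit_eq by (auto simp: setcompr_eq_image image_image act_rng)

lemma orbit_groupoid_src:
  "x \<in> arrows X \<Longrightarrow> src (orbit_groupoid X H act) (rorbit H act x) = rorbit H act (src X x)"
  unfolding orbit_groupoid_def rorbit_eq by (auto simp: setcompr_eq_image image_image act_src)

lemma orbit_groupoid_gmult:
  assumes fr: "free_action (gtop X) H act" and x: "x \<in> arrows X" and y: "y \<in> arrows X"
    and c: "src X x = rng X y"
  shows "gmult (orbit_groupoid X H act) (rorbit H act x) (rorbit H act y) = rorbit H act (gmult X x y)"
proof -
  have "h = k" if "h \<in> carrier H" "k \<in> carrier H" "src X (act x h) = rng X (act y k)" for h k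
    using free_eq[OF fr rng_closed[OF y] that(1,2)] that act_src[OF x] act_rng[OF y] c by simp
  then have "{gmult X x' y' | x' y'. x' \<in> rorbit H act x \<and> y' \<in> rorbit H act y \<and> src X x' = rng X y'}
      = {gmult X (act x h) (act y h) | h. h \<in> carrier H}"
    unfolding rorbit_eq using act_gmult(1)[OF x y c] by blast
  also have "\<dots> = rorbit H act (gmult X x y)"
    unfolding rorbit_eq using act_gmult(2)[OF x y c] by metis
  finally show ?thesis by (simp add: orbit_groupoid_def)
qed

end

context fell_bundle_action
begin

lemma bact_props:
  assumes "a \<in> topspace (btop A)" "h \<in> carrier H"
  shows "bact a h \<in> topspace (btop A)" "proj A (bact a h) = act (proj A a) h"
    "bnorm A (bact a h) = bnorm A a" "bact (bstar A a) h = bstar A (bact a h)"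
    "bact (bscale A c a) h = bscale A c (bact a h)"
  using bautomorphism[OF assms(2)] assms(1) unfolding fell_automorphism_def
  by (auto dest: bij_betwE)

lemma bact_badd:
  assumes "a \<in> topspace (btop A)" "b \<in> topspace (btop A)" "proj A a = proj A b" "h \<in> carrier H"
  shows "bact (badd A a b) h = badd A (bact a h) (bact b h)"
  using bautomorphism[OF assms(4)] assms(1-3) unfolding fell_automorphism_def by blast

lemma bact_bmult:
  assumes "a \<in> topspace (btop A)" "b \<in> topspace (btop A)" "bsrc X A a = brng X A b" "h \<in> carrier H"
  shows "bact (bmult A a b) h = bmult A (bact a h) (bact b h)"
  using bautomorphism[OF assms(4)] assms(1-3) unfolding fell_automorphism_def by blast

lemma proj_arrow: "a \<in> topspace (btop A) \<Longrightarrow> proj A a \<in> arrows X"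
  using surj_proj by blast

lemma orbit_bundle_bnorm:
  assumes "a \<in> topspace (btop A)"
  shows "bnorm (orbit_bundle X A H bact) (rorbit H bact a) = bnorm A a"
proof -
  have "bnorm A ` rorbit H bact a = {bnorm A a}"
    unfolding rorbit_eq setcompr_eq_image image_image Collect_mem_eq
    using assms bact_props(3) H.one_closed by (auto simp: image_constant_conv)
  then show ?thesis by (simp add: orbit_bundle_def)
qed

lemma orbit_bundle_bscale:
  "a \<in> topspace (btop A) \<Longrightarrow>
     bscale (orbit_bundle X A H bact) c (rorbit H bact a) = rorbit H bact (bscale A c a)"
  unfolding orbit_bundle_def rorbit_eq by (auto simp: setcompr_eq_image image_image bact_props(5))

lemma orbit_bundle_badd:
  assumes fr: "free_action (gtop X) H act"
    and a: "a \<in> topspace (btop A)" and b: "b \<in> topspace (btop A)" and c: "proj A a = proj A b"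
  shows "badd (orbit_bundle X A H bact) (rorbit H bact a) (rorbit H bact b)
           = rorbit H bact (badd A a b)"
proof -
  have "h = k" if "h \<in> carrier H" "k \<in> carrier H" "proj A (bact a h) = proj A (bact b k)" for h k
    using free_eq[OF fr proj_arrow[OF b] that(1,2)] that bact_props(2)[OF a] bact_props(2)[OF b] c
    by simp
  moreover have "proj A (bact a h) = proj A (bact b h)" if "h \<in> carrier H" for h
    using that bact_props(2)[OF a] bact_props(2)[OF b] c by simp
  ultimately have "{badd A a' b' | a' b'. a' \<in> rorbit H bact a \<and> b' \<in> rorbit H bact b \<and> proj A a' = proj A b'}
      = {badd A (bact a h) (bact b h) | h. h \<in> carrier H}"
    unfolding rorbit_eq by blast
  also have "\<dots> = rorbit H bact (badd A a b)"
    unfolding rorbit_eq using bact_badd[OF a b c] by metis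
  finally show ?thesis by (simp add: orbit_bundle_def)
qed

end

end

theory Submission
  imports Defs
begin

text \<open>
  Everything on the orbit level is computed on representatives.  Because \<open>H\<close> acts freely on the
  arrows, the map \<open>a \<mapsto> a\<cdot>H\<close> restricts to a bijection of the fibre over \<open>x\<close> onto the fibre over
  \<open>x\<cdot>H\<close>; it preserves the linear structure, the norm, the products and the involution, so all
  algebraic axioms, the \<open>C*\<close>-algebra structure over units and the imprimitivity bimodule structure
  over arrows are transported along it (\<open>fibre_iso\<close>, \<open>fibre_alg_iso\<close>,
  \<open>imprimitivity_bimodule_iso\<close>).  Composable orbits have composable representatives, and by
  freeness these are unique up to simultaneous translation.

  The topology needs properness.  The orbit maps are open, and a free proper action satisfies: if
  \<open>y\<close> and \<open>y\<cdot>h\<close> are both close to \<open>x\<close>, then \<open>h\<close> is close to the identity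
  (\<open>small_translations\<close>).  Hence orbits that are composable and close to \<open>a\<cdot>H\<close> and \<open>b\<cdot>H\<close> have
  composable representatives close to \<open>a\<close> and \<open>b\<close>, and a continuous partial operation on
  representatives induces a continuous operation on orbits (\<open>continuous_map_orbit_operation\<close>).
  This one lemma gives the continuity of the groupoid multiplication, of the addition and of the
  multiplication of the orbit bundle.  Another consequence is that the total space is the
  pullback of its orbit space along the orbit map of the arrows
  (\<open>continuous_map_into_pullback\<close>).

  The remaining point is separability of the \<open>C\<^sub>0\<close>-sections of the orbit bundle.  By the pullback
  property a section \<open>F\<close> of the orbit bundle lifts to an equivariant continuous section \<open>f\<close> of the
  given bundle.  Choose countably many compact sets \<open>K\<close> of arrows whose images exhaust the orbit
  space, with compactly supported functions \<open>\<phi>\<^sub>K\<close> equal to \<open>1\<close> on \<open>K\<close>.  Then \<open>\<phi>\<^sub>K f\<close> is a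
  \<open>C\<^sub>0\<close>-section of the given bundle and determines \<open>F\<close> on the image of \<open>K\<close>, while \<open>F\<close> is small
  off that image for suitable \<open>K\<close>.  So a countable dense set of sections of the given bundle yields
  a countable dense set of sections of the orbit bundle (\<open>orbit_separable\<close>).
\<close>

section \<open>Orbit spaces of free and proper actions\<close>

lemma openin_prod_boxE:
  assumes "openin (prod_topology T1 T2) S" "(x, y) \<in> S"
  obtains U V where "openin T1 U" "openin T2 V" "x \<in> U" "y \<in> V" "U \<times> V \<subseteq> S"
  using iffD1[OF openin_prod_topology_alt assms(1), rule_format, OF assms(2)] that
  by (elim exE conjE)

text \<open>Both the action on the arrows and the action on the total space of the bundle are of this
  kind.\<close>

locale right_action = H: lc_group H TH
  for H :: "('h, 'k) monoid_scheme" and TH +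
  fixes T :: "'y topology" and act :: "'y \<Rightarrow> 'h \<Rightarrow> 'y"
  assumes continuous_action: "continuous_map (prod_topology T TH) T (\<lambda>(y, h). act y h)"
    and action_one: "y \<in> topspace T \<Longrightarrow> act y \<one>\<^bsub>H\<^esub> = y"
    and action_action: "\<lbrakk>y \<in> topspace T; h \<in> carrier H; k \<in> carrier H\<rbrakk>
          \<Longrightarrow> act (act y h) k = act y (h \<otimes>\<^bsub>H\<^esub> k)"
begin

abbreviation "orb \<equiv> rorbit H act"
abbreviation "quot \<equiv> quotient_topology T orb"

lemma action_closed:
  assumes "y \<in> topspace T" "h \<in> carrier H" shows "act y h \<in> topspace T"
proof -
  have "(y, h) \<in> topspace (prod_topology T TH)" using assms H.topspace_eq by simp
  from funcset_mem[OF continuous_map_funspace[OF continuous_action] this] show ?thesis by simp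
qed

lemma orb_action:
  assumes y: "y \<in> topspace T" and h: "h \<in> carrier H"
  shows "orb (act y h) = orb y"
proof -
  have "act y k = act (act y h) (inv\<^bsub>H\<^esub> h \<otimes>\<^bsub>H\<^esub> k)" if "k \<in> carrier H" for k
    using y h that by (simp add: action_action H.m_assoc[symmetric])
  moreover have "act (act y h) k = act y (h \<otimes>\<^bsub>H\<^esub> k)" if "k \<in> carrier H" for k
    using y h that by (simp add: action_action)
  ultimately show ?thesis
    unfolding rorbit_eq using h by (blast intro: H.m_closed H.inv_closed)
qed

lemma self_in_orb: "y \<in> topspace T \<Longrightarrow> y \<in> orb y"
  unfolding rorbit_eq using action_one[of y] H.one_closed by (metis (mono_tags, lifting) mem_Collect_eq)

lemma orb_eqD:
  assumes "y \<in> topspace T" "z \<in> topspace T" "orb y = orb z"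
  shows "\<exists>h\<in>carrier H. z = act y h"
proof -
  have "z \<in> orb y" using self_in_orb assms by simp
  then show ?thesis unfolding rorbit_eq by blast
qed

lemma continuous_translate:
  assumes "h \<in> carrier H" shows "continuous_map T T (\<lambda>y. act y h)"
proof -
  have "continuous_map T (prod_topology T TH) (\<lambda>y. (y, h))"
    using assms H.topspace_eq by (intro continuous_map_pairedI) auto
  from continuous_map_compose[OF this continuous_action] show ?thesis
    by (simp add: o_def)
qed

lemma continuous_orb: "continuous_map T quot orb"
  by (simp add: quotient_imp_continuous_map quotient_map_quotient_topology)

text \<open>The saturation of an open set is a union of translates of it.\<close>

lemma open_map_orb: "open_map T quot orb"
  unfolding open_map_def
proof (intro allI impI)
  fix U assume U: "openin T U"
  then have sub: "U \<subseteq> topspace T" by (rule openin_subset)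
  have "{y \<in> topspace T. orb y \<in> orb ` U} = (\<Union>h\<in>carrier H. {y \<in> topspace T. act y h \<in> U})"
  proof (intro equalityI subsetI)
    fix y assume "y \<in> {y \<in> topspace T. orb y \<in> orb ` U}"
    then obtain u where "y \<in> topspace T" "u \<in> U" "orb y = orb u" by blast
    moreover from this obtain h where "h \<in> carrier H" "u = act y h"
      using sub orb_eqD[of y u] by blast
    ultimately show "y \<in> (\<Union>h\<in>carrier H. {y \<in> topspace T. act y h \<in> U})"
      by blast
  next
    fix y assume "y \<in> (\<Union>h\<in>carrier H. {y \<in> topspace T. act y h \<in> U})"
    then obtain h where h: "h \<in> carrier H" "y \<in> topspace T" "act y h \<in> U" by blast
    then have "orb y = orb (act y h)" by (simp add: orb_action)
    then show "y \<in> {y \<in> topspace T. orb y \<in> orb ` U}" using h by blast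
  qed
  moreover have "openin T (\<Union>h\<in>carrier H. {y \<in> topspace T. act y h \<in> U})"
    using openin_continuous_map_preimage[OF continuous_translate U] by (intro openin_Union) blast
  ultimately show "openin quot (orb ` U)"
    using sub by (auto simp: openin_quotient_topology)
qed

lemma action_nhd:
  assumes y: "y \<in> topspace T" and V: "openin T V" "y \<in> V"
  obtains W N where "openin T W" "y \<in> W" "openin TH N" "\<one>\<^bsub>H\<^esub> \<in> N"
    "\<And>z h. z \<in> W \<Longrightarrow> h \<in> N \<Longrightarrow> act z h \<in> V"
proof -
  let ?P = "{p \<in> topspace (prod_topology T TH). (\<lambda>(y, h). act y h) p \<in> V}"
  have "openin (prod_topology T TH) ?P"
    by (rule openin_continuous_map_preimage[OF continuous_action V(1)])
  moreover have "(y, \<one>\<^bsub>H\<^esub>) \<in> ?P" using y V action_one H.topspace_eq by simp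
  ultimately obtain W N where "openin T W" "openin TH N" "y \<in> W" "\<one>\<^bsub>H\<^esub> \<in> N" "W \<times> N \<subseteq> ?P"
    by (rule openin_prod_boxE)
  show thesis
  proof (rule that[of W N])
    fix z h assume "z \<in> W" "h \<in> N"
    then have "(z, h) \<in> ?P" using \<open>W \<times> N \<subseteq> ?P\<close> by blast
    then show "act z h \<in> V" by simp
  qed fact+
qed

end

locale principal_action = right_action +
  assumes free: "free_action T H act"
    and proper: "proper_action T TH act"
begin

text \<open>A proper map is closed, so the pairs \<open>(y\<cdot>h, y)\<close> with \<open>h\<close> outside \<open>N\<close> form a closed set;
  by freeness it does not contain \<open>(x, x)\<close>.  In other words, the translation function
  \<open>(y\<cdot>h, y) \<mapsto> h\<close> is continuous at the diagonal.\<close>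

lemma small_translations:
  assumes x: "x \<in> topspace T" and N: "openin TH N" "\<one>\<^bsub>H\<^esub> \<in> N"
  obtains U where "openin T U" "x \<in> U"
    "\<And>y h. y \<in> U \<Longrightarrow> h \<in> carrier H \<Longrightarrow> act y h \<in> U \<Longrightarrow> h \<in> N"
proof -
  let ?f = "\<lambda>(x, h). (act x h, x)"
  let ?C = "?f ` (topspace T \<times> (topspace TH - N))"
  have "closed_map (prod_topology T TH) (prod_topology T T) ?f"
    using proper unfolding proper_action_def by (rule proper_imp_closed_map)
  moreover have "closedin (prod_topology T TH) (topspace T \<times> (topspace TH - N))"
    using closedin_diff[OF closedin_topspace N(1)] by (simp add: closedin_prod_Times_iff)
  ultimately have "closedin (prod_topology T T) ?C"
    unfolding closed_map_def by blast
  then have op: "openin (prod_topology T T) (topspace (prod_topology T T) - ?C)"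
    by (rule openin_diff[OF openin_topspace])
  have "(x, x) \<notin> ?C"
  proof
    assume "(x, x) \<in> ?C"
    then obtain h where "h \<in> topspace TH - N" "act x h = x" by auto
    then show False using free x N H.topspace_eq unfolding free_action_def by blast
  qed
  then have "(x, x) \<in> topspace (prod_topology T T) - ?C" using x by simp
  with op obtain U V where UV: "openin T U" "openin T V" "x \<in> U" "x \<in> V"
    "U \<times> V \<subseteq> topspace (prod_topology T T) - ?C"
    by (rule openin_prod_boxE)
  show thesis
  proof (rule that)
    show "openin T (U \<inter> V)" using UV(1,2) by (rule openin_Int)
    show "x \<in> U \<inter> V" using UV(3,4) by (rule IntI)
    fix y h assume y: "y \<in> U \<inter> V" and h: "h \<in> carrier H" and yh: "act y h \<in> U \<inter> V"
    then have nC: "(act y h, y) \<notin> ?C" using UV(5) by blast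
    have yT: "y \<in> topspace T" using y openin_subset[OF UV(1)] by blast
    show "h \<in> N"
    proof (rule ccontr)
      assume "h \<notin> N"
      then have "(act y h, y) \<in> ?C"
        using yT h H.topspace_eq by (intro image_eqI[where x = "(y, h)"]) auto
      then show False using nC by contradiction
    qed
  qed
qed

text \<open>The orbit map is open and, by properness, the orbit equivalence relation is closed.\<close>

lemma Hausdorff_space_quot: "Hausdorff_space quot"
  unfolding Hausdorff_space_def
proof (intro allI impI)
  fix P Q assume PQ: "P \<in> topspace quot \<and> Q \<in> topspace quot \<and> P \<noteq> Q"
  then obtain x y where x: "x \<in> topspace T" "P = orb x" and y: "y \<in> topspace T" "Q = orb y"
    by auto
  let ?f = "\<lambda>(x, h). (act x h, x)"
  let ?C = "?f ` (topspace T \<times> topspace TH)"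
  have "closed_map (prod_topology T TH) (prod_topology T T) ?f"
    using proper unfolding proper_action_def by (rule proper_imp_closed_map)
  moreover have "closedin (prod_topology T TH) (topspace T \<times> topspace TH)"
    by (simp add: closedin_prod_Times_iff)
  ultimately have "closedin (prod_topology T T) ?C"
    unfolding closed_map_def by blast
  then have op: "openin (prod_topology T T) (topspace (prod_topology T T) - ?C)"
    by (rule openin_diff[OF openin_topspace])
  have "(x, y) \<notin> ?C"
  proof
    assume "(x, y) \<in> ?C"
    then obtain h where "h \<in> topspace TH" "x = act y h" by auto
    then show False using PQ x y orb_action H.topspace_eq by simp
  qed
  then have "(x, y) \<in> topspace (prod_topology T T) - ?C" using x y by simp
  with op obtain U V where UV: "openin T U" "openin T V" "x \<in> U" "y \<in> V"
    "U \<times> V \<subseteq> topspace (prod_topology T T) - ?C"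
    by (rule openin_prod_boxE)
  have "orb u \<noteq> orb v" if uv: "u \<in> U" "v \<in> V" for u v
  proof
    assume e: "orb u = orb v"
    have uvT: "u \<in> topspace T" "v \<in> topspace T"
      using uv openin_subset[OF UV(1)] openin_subset[OF UV(2)] by blast+
    then obtain h where "h \<in> carrier H" "u = act v h" using orb_eqD[of v u] e by metis
    then have "(u, v) \<in> ?C"
      using uvT H.topspace_eq by (intro image_eqI[where x = "(v, h)"]) auto
    then show False using uv UV(5) by blast
  qed
  then have "disjnt (orb ` U) (orb ` V)" unfolding disjnt_def by blast
  moreover have "openin quot (orb ` U)" "openin quot (orb ` V)"
    using open_map_orb UV unfolding open_map_def by auto
  ultimately show "\<exists>U V. openin quot U \<and> openin quot V \<and> P \<in> U \<and> Q \<in> V \<and> disjnt U V"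
    using x y UV by blast
qed

lemma lchs_space_quot:
  assumes "lchs_space T" shows "lchs_space quot"
proof -
  have im: "orb ` topspace T = topspace quot" by simp
  show ?thesis
    using assms Hausdorff_space_quot
      locally_compact_space_continuous_open_map_image[OF continuous_orb open_map_orb im]
      second_countable_open_map_image[OF continuous_orb open_map_orb im]
    unfolding lchs_space_def by simp
qed

end

text \<open>Composable orbits near \<open>(a\<cdot>H, b\<cdot>H)\<close> have composable representatives near \<open>(a, b)\<close>: nearby
  representatives \<open>c\<close>, \<open>d\<close> satisfy \<open>f c = g (d\<cdot>h)\<close> for some \<open>h\<close>, and \<open>h\<close> is close to the
  identity because both \<open>f c\<close> and \<open>g d\<close> are close to \<open>f a = g b\<close>.  A continuous partial operation
  \<open>m\<close> on representatives therefore descends to a continuous operation \<open>m'\<close> on orbits, whose domain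
  is described by \<open>C\<close>.\<close>

lemma continuous_map_orbit_operation:
  assumes 1: "right_action H TH T1 act1" and 2: "right_action H TH T2 act2"
    and 3: "right_action H TH T3 act3"
    and base: "principal_action H TH T act"
    and f: "continuous_map T1 T f" and g: "continuous_map T2 T g"
    and g_act: "\<And>b h. b \<in> topspace T2 \<Longrightarrow> h \<in> carrier H \<Longrightarrow> g (act2 b h) = act (g b) h"
    and m: "continuous_map (subtopology (prod_topology T1 T2) {(a, b). f a = g b}) T3 (\<lambda>(a, b). m a b)"
    and C: "\<And>a b. a \<in> topspace T1 \<Longrightarrow> b \<in> topspace T2 \<Longrightarrow>
              C (rorbit H act1 a) (rorbit H act2 b) \<longleftrightarrow> rorbit H act (f a) = rorbit H act (g b)"
    and m': "\<And>a b. a \<in> topspace T1 \<Longrightarrow> b \<in> topspace T2 \<Longrightarrow> f a = g b \<Longrightarrow>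
              m' (rorbit H act1 a) (rorbit H act2 b) = rorbit H act3 (m a b)"
  shows "continuous_map
           (subtopology (prod_topology (quotient_topology T1 (rorbit H act1))
              (quotient_topology T2 (rorbit H act2))) {(P, Q). C P Q})
           (quotient_topology T3 (rorbit H act3)) (\<lambda>(P, Q). m' P Q)"
proof -
  interpret A1: right_action H TH T1 act1 by (rule 1)
  interpret A2: right_action H TH T2 act2 by (rule 2)
  interpret A3: right_action H TH T3 act3 by (rule 3)
  interpret B: principal_action H TH T act by (rule base)
  let ?S = "subtopology (prod_topology A1.quot A2.quot) {(P, Q). C P Q}"
  have fT: "f a \<in> topspace T" if "a \<in> topspace T1" for a
    using that f by (auto simp: continuous_map_def)
  have gT: "g b \<in> topspace T" if "b \<in> topspace T2" for b
    using that g by (auto simp: continuous_map_def)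
  have mT: "m a b \<in> topspace T3" if "a \<in> topspace T1" "b \<in> topspace T2" "f a = g b" for a b
    using that funcset_mem[OF continuous_map_funspace[OF m], of "(a, b)"] by simp
  have lift: "\<exists>h\<in>carrier H. f a = g (act2 b h)"
    if "a \<in> topspace T1" "b \<in> topspace T2" "C (A1.orb a) (A2.orb b)" for a b
    using that C[of a b] B.orb_eqD[of "g b" "f a"] gT fT g_act by metis
  have rep: "\<exists>a b. a \<in> topspace T1 \<and> b \<in> topspace T2 \<and> f a = g b \<and> P = A1.orb a \<and> Q = A2.orb b"
    if PQ: "(P, Q) \<in> topspace ?S" for P Q
  proof -
    obtain a b where ab: "a \<in> topspace T1" "b \<in> topspace T2" "P = A1.orb a" "Q = A2.orb b" "C P Q"
      using PQ by auto
    with lift obtain h where "h \<in> carrier H" "f a = g (act2 b h)" by metis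
    then show ?thesis using ab A2.orb_action A2.action_closed by metis
  qed
  show ?thesis
    unfolding continuous_map_eq_topcontinuous_at topcontinuous_at_def
  proof (intro ballI conjI allI impI)
    show "(\<lambda>(P, Q). m' P Q) \<in> topspace ?S \<rightarrow> topspace A3.quot"
    proof
      fix p assume "p \<in> topspace ?S"
      then obtain a b where "a \<in> topspace T1" "b \<in> topspace T2" "f a = g b" "p = (A1.orb a, A2.orb b)"
        using rep[of "fst p" "snd p"] by (metis prod.collapse)
      then show "(case p of (P, Q) \<Rightarrow> m' P Q) \<in> topspace A3.quot" using m' mT by simp
    qed
  next
    fix p V assume p: "p \<in> topspace ?S" and V: "openin A3.quot V \<and> (case p of (P, Q) \<Rightarrow> m' P Q) \<in> V"
    obtain a b where ab: "a \<in> topspace T1" "b \<in> topspace T2" "f a = g b" "p = (A1.orb a, A2.orb b)"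
      using rep[of "fst p" "snd p"] p by (metis prod.collapse)
    let ?V = "{d \<in> topspace T3. A3.orb d \<in> V}"
    have "openin T3 ?V" using V by (simp add: openin_quotient_topology)
    from openin_continuous_map_preimage[OF m this] obtain E where E: "openin (prod_topology T1 T2) E"
      "{p \<in> topspace (subtopology (prod_topology T1 T2) {(a, b). f a = g b}). (\<lambda>(a, b). m a b) p \<in> ?V}
        = E \<inter> {(a, b). f a = g b}"
      unfolding openin_subtopology by blast
    have "m' (A1.orb a) (A2.orb b) \<in> V" using V ab by simp
    then have "(a, b) \<in> E \<inter> {(a, b). f a = g b}"
      unfolding E(2)[symmetric] using ab m' mT by simp
    then have "(a, b) \<in> E" by blast
    with E(1) obtain U1 U2 where U: "openin T1 U1" "openin T2 U2" "a \<in> U1" "b \<in> U2" "U1 \<times> U2 \<subseteq> E"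
      by (rule openin_prod_boxE)
    \<comment> \<open>Shrink \<open>U2\<close> to \<open>W\<close>, leaving room for a translation by an element of \<open>N\<close>, and
      then choose \<open>Z\<close> so small that only such translations can occur.\<close>
    obtain W N where W: "openin T2 W" "b \<in> W" "openin TH N" "\<one>\<^bsub>H\<^esub> \<in> N"
      "\<And>z h. z \<in> W \<Longrightarrow> h \<in> N \<Longrightarrow> act2 z h \<in> U2"
      using A2.action_nhd[OF ab(2) U(2) U(4)] by blast
    obtain Z where Z: "openin T Z" "f a \<in> Z"
      "\<And>y h. y \<in> Z \<Longrightarrow> h \<in> carrier H \<Longrightarrow> act y h \<in> Z \<Longrightarrow> h \<in> N"
      using B.small_translations[OF fT[OF ab(1)] W(3,4)] by blast
    let ?U1 = "U1 \<inter> {a \<in> topspace T1. f a \<in> Z}" and ?W = "W \<inter> {b \<in> topspace T2. g b \<in> Z}"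
    have o1: "openin T1 ?U1" and o2: "openin T2 ?W"
      using U(1) W(1) openin_continuous_map_preimage[OF f Z(1)] openin_continuous_map_preimage[OF g Z(1)]
      by (auto intro: openin_Int)
    let ?R = "(A1.orb ` ?U1) \<times> (A2.orb ` ?W) \<inter> {(P, Q). C P Q}"
    have "openin (prod_topology A1.quot A2.quot) ((A1.orb ` ?U1) \<times> (A2.orb ` ?W))"
      using o1 o2 A1.open_map_orb A2.open_map_orb
      by (simp add: openin_prod_Times_iff open_map_def)
    then have "openin ?S ?R" by (rule openin_subtopology_Int)
    moreover have "p \<in> ?R"
      using ab C[OF ab(1,2)] U(3) W(2) Z(2) by auto
    moreover have "(case q of (P, Q) \<Rightarrow> m' P Q) \<in> V" if q: "q \<in> ?R" for q
    proof -
      obtain c d where cd: "c \<in> ?U1" "d \<in> ?W" "q = (A1.orb c, A2.orb d)" "C (A1.orb c) (A2.orb d)"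
        using q by auto
      have c: "c \<in> topspace T1" and d: "d \<in> topspace T2" using cd by auto
      obtain h where h: "h \<in> carrier H" "f c = g (act2 d h)" using lift[OF c d cd(4)] by blast
      have "h \<in> N" using Z(3)[of "g d" h] cd h g_act[OF d h(1)] by auto
      then have "act2 d h \<in> U2" using W(5) cd by auto
      then have "(c, act2 d h) \<in> E \<inter> {(a, b). f a = g b}" using U(5) cd h by auto
      then have "A3.orb (m c (act2 d h)) \<in> V" unfolding E(2)[symmetric] by auto
      moreover have "m' (A1.orb c) (A2.orb (act2 d h)) = A3.orb (m c (act2 d h))"
        using m'[OF c A2.action_closed[OF d h(1)] h(2)] .
      ultimately show ?thesis using cd(3) A2.orb_action[OF d h(1)] by simp
    qed
    ultimately show "\<exists>U. openin ?S U \<and> p \<in> U \<and> (\<forall>y\<in>U. (case y of (P, Q) \<Rightarrow> m' P Q) \<in> V)"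
      by blast
  qed
qed

lemma continuous_map_orbit:
  assumes 1: "right_action H TH T1 act1" and 2: "right_action H TH T2 act2"
    and f: "continuous_map T1 T2 f"
    and f': "\<And>a. a \<in> topspace T1 \<Longrightarrow> f' (rorbit H act1 a) = rorbit H act2 (f a)"
  shows "continuous_map (quotient_topology T1 (rorbit H act1)) (quotient_topology T2 (rorbit H act2)) f'"
proof -
  interpret A1: right_action H TH T1 act1 by (rule 1)
  interpret A2: right_action H TH T2 act2 by (rule 2)
  have "continuous_map T1 A2.quot (A2.orb \<circ> f)"
    using continuous_map_compose[OF f A2.continuous_orb] .
  then have "continuous_map T1 A2.quot (f' \<circ> A1.orb)"
    by (rule continuous_map_eq) (simp add: f')
  then show ?thesis
    using continuous_compose_quotient_map[OF quotient_map_quotient_topology] by blast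
qed

section \<open>The orbit groupoid\<close>

context lc_groupoid
begin

lemma ginv_unique:
  assumes x: "x \<in> arrows X" and y: "y \<in> arrows X" and c: "src X y = rng X x"
    and yx: "gmult X y x = src X x"
  shows "y = ginv X x"
proof -
  have "y = gmult X y (gmult X x (ginv X x))"
    using x y c src_gmult_right[OF y] by (simp add: gmult_ginv_right)
  also have "\<dots> = gmult X (gmult X y x) (ginv X x)"
    using x y c by (simp add: gmult_assoc ginv_closed rng_ginv)
  also have "\<dots> = ginv X x"
    using x yx rng_gmult_left[OF ginv_closed[OF x]] by (simp add: rng_ginv)
  finally show ?thesis .
qed

text \<open>The range map is continuous because \<open>r(x) = x x\<^sup>-\<^sup>1\<close>.\<close>

lemma continuous_rng: "continuous_map (gtop X) (gtop X) (rng X)"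
proof -
  have "continuous_map (gtop X)
      (subtopology (prod_topology (gtop X) (gtop X)) {(x, y). src X x = rng X y}) (\<lambda>x. (x, ginv X x))"
    by (intro continuous_map_into_subtopology continuous_map_pairedI continuous_ginv continuous_map_id[unfolded id_def])
      (auto simp: rng_ginv)
  from continuous_map_compose[OF this continuous_gmult]
  have "continuous_map (gtop X) (gtop X) (\<lambda>x. gmult X x (ginv X x))"
    by (simp add: o_def)
  then show ?thesis by (rule continuous_map_eq) (simp add: gmult_ginv_right)
qed

lemma continuous_src: "continuous_map (gtop X) (gtop X) (src X)"
proof (rule continuous_map_eq)
  show "continuous_map (gtop X) (gtop X) (rng X \<circ> ginv X)"
    by (rule continuous_map_compose[OF continuous_ginv continuous_rng])
qed (simp add: rng_ginv)

lemma unit_arrow: "u \<in> units X \<Longrightarrow> u \<in> arrows X"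
  unfolding units_def by (auto simp: rng_closed)

end

locale free_proper_groupoid_action = groupoid_action +
  assumes free: "free_action (gtop X) H act"
    and proper: "proper_action (gtop X) TH act"
begin

sublocale arr: principal_action H TH "gtop X" act
proof unfold_locales
  show "continuous_map (prod_topology (gtop X) TH) (gtop X) (\<lambda>(x, h). act x h)"
    by (rule continuous_act)
  show "act x \<one>\<^bsub>H\<^esub> = x" if "x \<in> arrows X" for x using that by (rule act_one)
  show "act (act x h) k = act x (h \<otimes>\<^bsub>H\<^esub> k)"
    if "x \<in> arrows X" "h \<in> carrier H" "k \<in> carrier H" for x h k
    using that by (rule act_act)
qed (fact free proper)+

lemma arrows_orbit [simp]: "arrows (orbit_groupoid X H act) = arr.orb ` arrows X"
  by (simp add: orbit_groupoid_def)

lemma act_ginv: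
  assumes x: "x \<in> arrows X" and h: "h \<in> carrier H"
  shows "ginv X (act x h) = act (ginv X x) h"
proof (rule ginv_unique[symmetric])
  show "src X (act (ginv X x) h) = rng X (act x h)"
    using x h by (simp add: act_src act_rng ginv_closed src_ginv)
  have "gmult X (act (ginv X x) h) (act x h) = act (gmult X (ginv X x) x) h"
    using act_gmult(2)[OF ginv_closed[OF x] x src_ginv[OF x] h] by simp
  then show "gmult X (act (ginv X x) h) (act x h) = src X (act x h)"
    using x h by (simp add: gmult_ginv_left act_src)
qed (use x h in \<open>simp_all add: act_closed ginv_closed\<close>)

lemma orbit_groupoid_ginv:
  "x \<in> arrows X \<Longrightarrow> ginv (orbit_groupoid X H act) (arr.orb x) = arr.orb (ginv X x)"
  unfolding orbit_groupoid_def rorbit_eq by (auto simp: setcompr_eq_image image_image act_ginv)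

lemmas orbit_groupoid_simps =
  orbit_groupoid_rng orbit_groupoid_src orbit_groupoid_ginv orbit_groupoid_gmult[OF free]

lemma composable_lift:
  assumes x: "x \<in> arrows X" and Q: "Q \<in> arrows (orbit_groupoid X H act)"
    and c: "src (orbit_groupoid X H act) (arr.orb x) = rng (orbit_groupoid X H act) Q"
  shows "\<exists>y\<in>arrows X. Q = arr.orb y \<and> src X x = rng X y"
proof -
  obtain y where y: "y \<in> arrows X" "Q = arr.orb y" using Q by auto
  then have "arr.orb (rng X y) = arr.orb (src X x)"
    using c x by (simp add: orbit_groupoid_simps)
  then obtain h where h: "h \<in> carrier H" "src X x = act (rng X y) h"
    using arr.orb_eqD[OF rng_closed[OF y(1)] src_closed[OF x]] by blast
  then show ?thesis
    using y by (intro bexI[of _ "act y h"]) (simp_all add: act_rng arr.orb_action act_closed)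
qed

lemma units_orbit: "units (orbit_groupoid X H act) = arr.orb ` units X"
  unfolding units_def arrows_orbit image_image by (auto simp: orbit_groupoid_simps)

text \<open>Composable orbits, in pairs or in triples, are lifted from left to right to composable
  arrows; each axiom is then the corresponding axiom for these arrows.\<close>

theorem lc_groupoid_orbit_groupoid: "lc_groupoid (orbit_groupoid X H act)"
proof -
  let ?G = "orbit_groupoid X H act"
  note simps = orbit_groupoid_simps rng_closed src_closed gmult_closed ginv_closed rng_rng src_rng
    rng_src src_src rng_gmult src_gmult gmult_assoc rng_gmult_left src_gmult_right rng_ginv src_ginv
    gmult_ginv_right gmult_ginv_left
  have comp: "\<exists>x\<in>arrows X. \<exists>y\<in>arrows X. P = arr.orb x \<and> Q = arr.orb y \<and> src X x = rng X y"
    if PQ: "P \<in> arrows ?G" "Q \<in> arrows ?G" "src ?G P = rng ?G Q" for P Q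
  proof -
    obtain x where x: "x \<in> arrows X" "P = arr.orb x" using PQ(1) by auto
    then show ?thesis using composable_lift[OF x(1) PQ(2)] PQ(3) by auto
  qed
  show ?thesis
  proof (rule lc_groupoid.intro)
    show "lchs_space (gtop ?G)"
      using arr.lchs_space_quot[OF lchs] by (simp add: orbit_groupoid_def)
  next
    fix P Q assume PQ: "P \<in> arrows ?G" "Q \<in> arrows ?G" "src ?G P = rng ?G Q"
    then obtain x y where "x \<in> arrows X" "y \<in> arrows X" "P = arr.orb x" "Q = arr.orb y"
      "src X x = rng X y" using comp by blast
    then show "gmult ?G P Q \<in> arrows ?G" "rng ?G (gmult ?G P Q) = rng ?G P"
      "src ?G (gmult ?G P Q) = src ?G Q"
      by (simp_all add: simps)
  next
    fix P Q R assume P: "P \<in> arrows ?G" "Q \<in> arrows ?G" "R \<in> arrows ?G"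
      "src ?G P = rng ?G Q" "src ?G Q = rng ?G R"
    then obtain x y where x: "x \<in> arrows X" "y \<in> arrows X" "P = arr.orb x" "Q = arr.orb y"
      "src X x = rng X y" using comp by blast
    moreover from this P obtain z where "z \<in> arrows X" "R = arr.orb z" "src X y = rng X z"
      using composable_lift[of y R] by blast
    ultimately show "gmult ?G (gmult ?G P Q) R = gmult ?G P (gmult ?G Q R)"
      by (simp add: simps)
  next
    have f: "continuous_map (gtop X) (gtop X) (src X)" "continuous_map (gtop X) (gtop X) (rng X)"
      by (rule continuous_src continuous_rng)+
    have "continuous_map
        (subtopology (prod_topology arr.quot arr.quot) {(P, Q). src ?G P = rng ?G Q})
        arr.quot (\<lambda>(P, Q). gmult ?G P Q)"
    proof (rule continuous_map_orbit_operation[OF _ _ _ _ f])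
      show "principal_action H TH (gtop X) act" by (rule arr.principal_action_axioms)
    qed (simp_all add: arr.right_action_axioms act_rng orbit_groupoid_simps continuous_gmult)
    then show "continuous_map
        (subtopology (prod_topology (gtop ?G) (gtop ?G)) {(P, Q). src ?G P = rng ?G Q})
        (gtop ?G) (\<lambda>(P, Q). gmult ?G P Q)"
      by (simp add: orbit_groupoid_def)
  next
    have "continuous_map arr.quot arr.quot (ginv ?G)"
      by (rule continuous_map_orbit[OF arr.right_action_axioms arr.right_action_axioms continuous_ginv])
        (rule orbit_groupoid_ginv)
    then show "continuous_map (gtop ?G) (gtop ?G) (ginv ?G)"
      by (simp add: orbit_groupoid_def)
  qed (auto simp: simps)
qed

end

section \<open>Transport of Banach spaces, C*-algebras and bimodules along isomorphisms\<close>

lemma mcomplete_isometric_image: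
  assumes M: "Metric_space M d" and M': "Metric_space (f ` M) d'"
    and iso: "\<And>x y. x \<in> M \<Longrightarrow> y \<in> M \<Longrightarrow> d' (f x) (f y) = d x y"
    and complete: "Metric_space.mcomplete M d"
  shows "Metric_space.mcomplete (f ` M) d'"
proof -
  interpret M: Metric_space M d by (rule M)
  interpret M': Metric_space "f ` M" d' by (rule M')
  show ?thesis
    unfolding M'.mcomplete_def
  proof (intro allI impI)
    fix \<sigma> assume \<sigma>: "M'.MCauchy \<sigma>"
    then have "\<forall>n. \<exists>x\<in>M. \<sigma> n = f x" unfolding M'.MCauchy_def by blast
    then obtain \<tau> where \<tau>: "\<And>n. \<tau> n \<in> M" "\<And>n. \<sigma> n = f (\<tau> n)" by metis
    then have "M.MCauchy \<tau>"
      using \<sigma> unfolding M.MCauchy_def M'.MCauchy_def by (auto simp: iso)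
    then obtain l where l: "limitin M.mtopology \<tau> l sequentially"
      using complete unfolding M.mcomplete_def by blast
    then have "limitin M'.mtopology \<sigma> (f l) sequentially"
      unfolding M.limit_metric_sequentially M'.limit_metric_sequentially
      using \<tau> by (auto simp: iso)
    then show "\<exists>x. limitin M'.mtopology \<sigma> x sequentially" by blast
  qed
qed

context complex_banach_space
begin

lemma scale_zero: assumes "a \<in> vcarrier E" shows "vscale E 0 a = vzero E"
  using norm_scale[OF assms, of 0] norm_eq_0[OF scale_closed[OF assms]] by simp

lemma add_minus: assumes "a \<in> vcarrier E" shows "vadd E (vscale E (- 1) a) a = vzero E"
  using scale_add_left[OF assms, of "- 1" 1] assms by (simp add: scale_zero scale_one)

lemma Metric_space_vdist: "Metric_space (vcarrier E) (vdist E)"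
proof
  note closed = add_closed scale_closed zero_closed
  fix x y
  show "0 \<le> vdist E x y" by (simp add: vdist_def closed norm_nonneg)
  show "vdist E x y = vdist E y x"
  proof (cases "x \<in> vcarrier E \<and> y \<in> vcarrier E")
    case True
    have "vscale E (- 1) (vadd E x (vscale E (- 1) y)) = vadd E y (vscale E (- 1) x)"
      using True by (simp add: scale_add_right scale_scale scale_one closed add_commute)
    then show ?thesis
      using True norm_scale[of "vadd E x (vscale E (- 1) y)" "- 1"] by (simp add: vdist_def closed)
  qed (auto simp: vdist_def)
  assume x: "x \<in> vcarrier E" and y: "y \<in> vcarrier E"
  have split: "vadd E (vadd E a (vscale E (- 1) y)) (vadd E y b) = vadd E a b"
    if ab: "a \<in> vcarrier E" "b \<in> vcarrier E" for a b
  proof -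
    have "vadd E (vadd E a (vscale E (- 1) y)) (vadd E y b)
        = vadd E a (vadd E (vadd E (vscale E (- 1) y) y) b)"
      using ab y by (simp add: add_assoc closed)
    then show ?thesis using ab y by (simp add: add_minus zero_add)
  qed
  show "(vdist E x y = 0) = (x = y)"
  proof
    assume "vdist E x y = 0"
    then have z: "vadd E x (vscale E (- 1) y) = vzero E"
      using x y by (simp add: vdist_def norm_eq_0 closed)
    have "vadd E (vadd E x (vscale E (- 1) y)) (vadd E y (vzero E)) = vadd E x (vzero E)"
      using split[OF x zero_closed] .
    then have "vadd E (vzero E) (vadd E (vzero E) y) = vadd E (vzero E) x"
      using x y add_commute[of _ "vzero E"] unfolding z by (simp add: closed)
    then show "x = y" using x y by (simp add: zero_add)
  next
    assume "x = y"
    then have "vadd E x (vscale E (- 1) y) = vzero E"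
      using add_commute[OF x scale_closed[OF x]] add_minus[OF x] by simp
    then show "vdist E x y = 0" using x y by (simp add: vdist_def norm_eq_0 closed)
  qed
  fix z assume z: "z \<in> vcarrier E"
  show "vdist E x z \<le> vdist E x y + vdist E y z"
    using norm_triangle[of "vadd E x (vscale E (- 1) y)" "vadd E y (vscale E (- 1) z)"]
      split[of x "vscale E (- 1) z"] x y z
    by (simp add: vdist_def closed)
qed

end

text \<open>The equations are oriented so that, used as rewrite rules, they pull every operation of the
  target back to the source.\<close>

locale normed_iso =
  fixes E :: "('e, 'm) normed_data_scheme" and F :: "('f, 'n) normed_data_scheme" and \<phi> :: "'e \<Rightarrow> 'f"
  assumes bij: "bij_betw \<phi> (vcarrier E) (vcarrier F)"
    and map_zero: "vzero F = \<phi> (vzero E)"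
    and map_add: "\<lbrakk>a \<in> vcarrier E; b \<in> vcarrier E\<rbrakk> \<Longrightarrow> vadd F (\<phi> a) (\<phi> b) = \<phi> (vadd E a b)"
    and map_scale: "a \<in> vcarrier E \<Longrightarrow> vscale F c (\<phi> a) = \<phi> (vscale E c a)"
    and map_norm: "a \<in> vcarrier E \<Longrightarrow> vnorm F (\<phi> a) = vnorm E a"
begin

lemma vcarrier_image: "vcarrier F = \<phi> ` vcarrier E"
  using bij by (simp add: bij_betw_def)

lemma map_eq_iff: "\<lbrakk>a \<in> vcarrier E; b \<in> vcarrier E\<rbrakk> \<Longrightarrow> \<phi> a = \<phi> b \<longleftrightarrow> a = b"
  using bij by (meson bij_betw_imp_inj_on inj_on_eq_iff)

lemmas map_simps = vcarrier_image map_zero map_add map_scale map_norm map_eq_iff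

lemma map_dist:
  assumes "complex_banach_space E" "a \<in> vcarrier E" "b \<in> vcarrier E"
  shows "vdist F (\<phi> a) (\<phi> b) = vdist E a b"
proof -
  interpret complex_banach_space E by fact
  show ?thesis using assms(2,3) by (simp add: vdist_def map_simps scale_closed add_closed)
qed

lemma complex_banach_space_iso:
  assumes "complex_banach_space E" shows "complex_banach_space F"
proof -
  interpret complex_banach_space E by fact
  note closed = zero_closed add_closed scale_closed
  have inv: "\<exists>b\<in>vcarrier F. vadd F a b = vzero F" if a: "a \<in> vcarrier F" for a
  proof -
    obtain a' where a': "a' \<in> vcarrier E" "a = \<phi> a'" using a by (auto simp: vcarrier_image)
    then obtain b where "b \<in> vcarrier E" "vadd E a' b = vzero E" using add_inverse by blast
    then show ?thesis using a' by (intro bexI[of _ "\<phi> b"]) (simp_all add: map_simps)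
  qed
  have metric: "Metric_space (\<phi> ` vcarrier E) (vdist F)"
  proof -
    interpret M: Metric_space "vcarrier E" "vdist E" by (rule Metric_space_vdist)
    have off: "vdist F x y = 0" if "x \<notin> \<phi> ` vcarrier E \<or> y \<notin> \<phi> ` vcarrier E" for x y
      using that by (auto simp: vdist_def vcarrier_image)
    show ?thesis
    proof
      fix x y
      show "0 \<le> vdist F x y"
        using off[of x y] map_dist[OF assms] by (cases "x \<in> \<phi> ` vcarrier E \<and> y \<in> \<phi> ` vcarrier E") auto
      show "vdist F x y = vdist F y x"
        using off[of x y] off[of y x] map_dist[OF assms] M.commute
        by (cases "x \<in> \<phi> ` vcarrier E \<and> y \<in> \<phi> ` vcarrier E") auto
    qed (auto simp: map_dist[OF assms] map_eq_iff M.triangle)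
  qed
  have "Metric_space.mcomplete (\<phi> ` vcarrier E) (vdist F)"
    by (rule mcomplete_isometric_image[OF Metric_space_vdist metric map_dist[OF assms] complete])
  then have "Metric_space.mcomplete (vcarrier F) (vdist F)" by (simp add: vcarrier_image)
  then show ?thesis
    using inv
    by (intro complex_banach_space.intro)
      (auto simp: map_simps closed add_assoc zero_add scale_one scale_scale scale_add_right
         scale_add_left norm_nonneg norm_eq_0 norm_scale norm_triangle intro: arg_cong[OF add_commute])
qed

text \<open>The preimage of a subspace is a subspace, so the subspace spanned by \<open>\<phi> ` S\<close> contains the
  image of the one spanned by \<open>S\<close>; the isometry \<open>\<phi>\<close> then carries approximations over.\<close>

lemma closed_span_image:
  assumes "complex_banach_space E"
    and span: "closed_span E S = vcarrier E"
    and S: "S \<subseteq> vcarrier E"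
  shows "closed_span F (\<phi> ` S) = vcarrier F"
proof -
  interpret E: complex_banach_space E by fact
  interpret F: complex_banach_space F by (rule complex_banach_space_iso) fact
  interpret ME: Metric_space "vcarrier E" "vdist E" by (rule E.Metric_space_vdist)
  interpret MF: Metric_space "vcarrier F" "vdist F" by (rule F.Metric_space_vdist)
  have sub: "\<phi> a \<in> csubspace_of F hull (\<phi> ` S)" if a: "a \<in> csubspace_of E hull S" for a
    unfolding hull_def
  proof
    fix W assume "W \<in> {W. csubspace_of F W \<and> \<phi> ` S \<subseteq> W}"
    then have W: "csubspace_of F W" "\<phi> ` S \<subseteq> W" by auto
    have "csubspace_of E {b \<in> vcarrier E. \<phi> b \<in> W}"
      using W(1) unfolding csubspace_of_def
      by (auto simp: E.zero_closed E.add_closed E.scale_closed map_zero map_add[symmetric] map_scale[symmetric])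
    moreover have "S \<subseteq> {b \<in> vcarrier E. \<phi> b \<in> W}" using S W(2) by blast
    ultimately have "a \<in> {b \<in> vcarrier E. \<phi> b \<in> W}"
      using a unfolding hull_def by blast
    then show "\<phi> a \<in> W" by blast
  qed
  have "\<phi> a \<in> closed_span F (\<phi> ` S)" if a: "a \<in> vcarrier E" for a
  proof -
    have "a \<in> ME.mtopology closure_of (csubspace_of E hull S)"
      using a span by (simp add: closed_span_def)
    then have cl: "\<forall>r>0. \<exists>y \<in> csubspace_of E hull S. y \<in> ME.mball a r"
      unfolding ME.metric_closure_of by simp
    show ?thesis
      unfolding closed_span_def MF.metric_closure_of
    proof (intro CollectI conjI allI impI)
      show "\<phi> a \<in> vcarrier F" using a by (simp add: vcarrier_image)
      fix r :: real assume "0 < r"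
      then obtain y where "y \<in> csubspace_of E hull S" "y \<in> ME.mball a r" using cl by blast
      moreover from this have "\<phi> y \<in> MF.mball (\<phi> a) r"
        unfolding MF.in_mball ME.in_mball by (simp add: vcarrier_image map_dist[OF assms(1)])
      ultimately show "\<exists>y \<in> csubspace_of F hull (\<phi> ` S). y \<in> MF.mball (\<phi> a) r"
        using sub by blast
    qed
  qed
  moreover have "closed_span F (\<phi> ` S) \<subseteq> vcarrier F"
    unfolding closed_span_def using closure_of_subset_topspace[of MF.mtopology] by simp
  ultimately show ?thesis by (auto simp: vcarrier_image)
qed

end

locale cstar_iso = normed_iso A B \<phi>
  for A :: "('a, 'm) cstar_data_scheme" and B :: "('b, 'n) cstar_data_scheme" and \<phi> +
  assumes map_mult: "\<lbrakk>a \<in> vcarrier A; b \<in> vcarrier A\<rbrakk> \<Longrightarrow> vmult B (\<phi> a) (\<phi> b) = \<phi> (vmult A a b)"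
    and map_star: "a \<in> vcarrier A \<Longrightarrow> vstar B (\<phi> a) = \<phi> (vstar A a)"
begin

lemma cstar_algebra_iso:
  assumes "cstar_algebra A" shows "cstar_algebra B"
proof -
  interpret cstar_algebra A by fact
  note closed = zero_closed add_closed scale_closed mult_closed star_closed
  have "complex_banach_space B" by (rule complex_banach_space_iso) (rule complex_banach_space_axioms)
  then show ?thesis
    by (intro cstar_algebra.intro cstar_algebra_axioms.intro)
      (auto simp: map_simps map_mult map_star closed mult_add_left mult_add_right mult_assoc
        mult_scale_left mult_scale_right star_star star_add star_scale star_mult norm_mult cstar_identity)
qed

lemma cstar_positive_iso:
  assumes "cstar_algebra A" "cstar_positive A a"
  shows "cstar_positive B (\<phi> a)"
proof -
  interpret cstar_algebra A by fact
  obtain b where "b \<in> vcarrier A" "a = vmult A (vstar A b) b"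
    using assms(2) unfolding cstar_positive_def by blast
  then show ?thesis
    unfolding cstar_positive_def
    by (intro bexI[of _ "\<phi> b"]) (simp_all add: map_mult map_star star_closed vcarrier_image)
qed

end

locale bimodule_iso =
  L: cstar_iso A A' \<phi> + R: cstar_iso B B' \<theta> + M: normed_iso E E' \<psi>
  for A :: "('a, 'm) cstar_data_scheme" and A' :: "('a1, 'm1) cstar_data_scheme" and \<phi>
    and B :: "('b, 'n) cstar_data_scheme" and B' :: "('b1, 'n1) cstar_data_scheme" and \<theta>
    and E :: "('e, 'k) normed_data_scheme" and E' :: "('e1, 'k1) normed_data_scheme" and \<psi> +
  fixes lact :: "'a \<Rightarrow> 'e \<Rightarrow> 'e" and ract :: "'e \<Rightarrow> 'b \<Rightarrow> 'e"
    and lip :: "'e \<Rightarrow> 'e \<Rightarrow> 'a" and rip :: "'e \<Rightarrow> 'e \<Rightarrow> 'b"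
    and lact' :: "'a1 \<Rightarrow> 'e1 \<Rightarrow> 'e1" and ract' :: "'e1 \<Rightarrow> 'b1 \<Rightarrow> 'e1"
    and lip' :: "'e1 \<Rightarrow> 'e1 \<Rightarrow> 'a1" and rip' :: "'e1 \<Rightarrow> 'e1 \<Rightarrow> 'b1"
  assumes map_lact: "\<lbrakk>a \<in> vcarrier A; x \<in> vcarrier E\<rbrakk> \<Longrightarrow> lact' (\<phi> a) (\<psi> x) = \<psi> (lact a x)"
    and map_ract: "\<lbrakk>x \<in> vcarrier E; b \<in> vcarrier B\<rbrakk> \<Longrightarrow> ract' (\<psi> x) (\<theta> b) = \<psi> (ract x b)"
    and map_lip: "\<lbrakk>x \<in> vcarrier E; y \<in> vcarrier E\<rbrakk> \<Longrightarrow> lip' (\<psi> x) (\<psi> y) = \<phi> (lip x y)"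
    and map_rip: "\<lbrakk>x \<in> vcarrier E; y \<in> vcarrier E\<rbrakk> \<Longrightarrow> rip' (\<psi> x) (\<psi> y) = \<theta> (rip x y)"
begin

lemma imprimitivity_bimodule_iso:
  assumes "imprimitivity_bimodule A B E lact ract lip rip"
  shows "imprimitivity_bimodule A' B' E' lact' ract' lip' rip'"
proof -
  interpret I: imprimitivity_bimodule A B E lact ract lip rip by fact
  have A': "cstar_algebra A'" by (rule L.cstar_algebra_iso) (rule I.L.A.cstar_algebra_axioms)
  have B': "cstar_algebra B'" by (rule R.cstar_algebra_iso) (rule I.R.B.cstar_algebra_axioms)
  have E': "complex_banach_space E'"
    by (rule M.complex_banach_space_iso) (rule I.L.E.complex_banach_space_axioms)
  note simps = L.map_simps R.map_simps M.map_simps L.map_mult R.map_mult L.map_star R.map_star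
    map_lact map_ract map_lip map_rip
    I.L.A.add_closed I.L.A.scale_closed I.L.A.mult_closed I.L.A.star_closed
    I.R.B.add_closed I.R.B.scale_closed I.R.B.mult_closed I.R.B.star_closed
    I.L.E.add_closed I.L.E.scale_closed
    I.L.act_closed I.R.act_closed I.L.ip_closed I.R.ip_closed
  have "{lip' x y |x y. x \<in> vcarrier E' \<and> y \<in> vcarrier E'}
      = \<phi> ` {lip x y |x y. x \<in> vcarrier E \<and> y \<in> vcarrier E}"
  proof -
    have "{lip' x y |x y. x \<in> vcarrier E' \<and> y \<in> vcarrier E'}
        = {lip' (\<psi> x) (\<psi> y) |x y. x \<in> vcarrier E \<and> y \<in> vcarrier E}"
      unfolding M.vcarrier_image by blast
    also have "\<dots> = {\<phi> (lip x y) |x y. x \<in> vcarrier E \<and> y \<in> vcarrier E}"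
      using map_lip by metis
    finally show ?thesis by blast
  qed
  then have Lfull: "closed_span A' {lip' x y |x y. x \<in> vcarrier E' \<and> y \<in> vcarrier E'} = vcarrier A'"
    by (simp only:) (rule L.closed_span_image[OF I.L.A.complex_banach_space_axioms I.L.full],
      use I.L.ip_closed in blast)
  have "{rip' x y |x y. x \<in> vcarrier E' \<and> y \<in> vcarrier E'}
      = \<theta> ` {rip x y |x y. x \<in> vcarrier E \<and> y \<in> vcarrier E}"
  proof -
    have "{rip' x y |x y. x \<in> vcarrier E' \<and> y \<in> vcarrier E'}
        = {rip' (\<psi> x) (\<psi> y) |x y. x \<in> vcarrier E \<and> y \<in> vcarrier E}"
      unfolding M.vcarrier_image by blast
    also have "\<dots> = {\<theta> (rip x y) |x y. x \<in> vcarrier E \<and> y \<in> vcarrier E}"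
      using map_rip by metis
    finally show ?thesis by blast
  qed
  then have Rfull: "closed_span B' {rip' x y |x y. x \<in> vcarrier E' \<and> y \<in> vcarrier E'} = vcarrier B'"
    by (simp only:) (rule R.closed_span_image[OF I.R.B.complex_banach_space_axioms I.R.full],
      use I.R.ip_closed in blast)
  have "full_left_hilbert_module A' E' lact' lip'"
    using A' E' Lfull
    by (intro full_left_hilbert_module.intro full_left_hilbert_module_axioms.intro)
      (auto simp: simps I.L.act_add_left I.L.act_add_right I.L.act_scale_left I.L.act_scale_right
        I.L.act_mult I.L.ip_add I.L.ip_scale I.L.ip_act I.L.ip_star I.L.ip_norm
        intro: L.cstar_positive_iso[OF I.L.A.cstar_algebra_axioms I.L.ip_positive])
  moreover have "full_right_hilbert_module B' E' ract' rip'"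
    using B' E' Rfull
    by (intro full_right_hilbert_module.intro full_right_hilbert_module_axioms.intro)
      (auto simp: simps I.R.act_add_left I.R.act_add_right I.R.act_scale_left I.R.act_scale_right
        I.R.act_mult I.R.ip_add I.R.ip_scale I.R.ip_act I.R.ip_star I.R.ip_norm
        intro: R.cstar_positive_iso[OF I.R.B.cstar_algebra_axioms I.R.ip_positive])
  ultimately show ?thesis
    by (intro imprimitivity_bimodule.intro imprimitivity_bimodule_axioms.intro)
      (auto simp: simps I.bimodule I.left_adjointable I.right_adjointable I.compatible)
qed

end

section \<open>Fibres, operations and topology of the orbit bundle\<close>

context banach_bundle
begin

lemma in_fibre [simp]: "a \<in> vcarrier (fibre B x) \<longleftrightarrow> a \<in> topspace (btop B) \<and> proj B a = x"
  by (simp add: fibre_def)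

lemma fibre_simps [simp]:
  "vzero (fibre B x) = bzero B x" "vadd (fibre B x) = badd B" "vscale (fibre B x) = bscale B"
  "vnorm (fibre B x) = bnorm B"
  by (simp_all add: fibre_def)

lemma proj_base: "a \<in> topspace (btop B) \<Longrightarrow> proj B a \<in> topspace T"
  using surj_proj by blast

lemma bzero_closed:
  assumes "x \<in> topspace T"
  shows "bzero B x \<in> topspace (btop B)" "proj B (bzero B x) = x"
  using complex_banach_space.zero_closed[OF banach_fibre[OF assms]] by simp_all

lemma badd_closed:
  assumes "a \<in> topspace (btop B)" "b \<in> topspace (btop B)" "proj B a = proj B b"
  shows "badd B a b \<in> topspace (btop B)" "proj B (badd B a b) = proj B b"
  using complex_banach_space.add_closed[OF banach_fibre[OF proj_base[OF assms(2)]], of a b] assms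
  by simp_all

lemma bscale_closed:
  assumes "a \<in> topspace (btop B)"
  shows "bscale B c a \<in> topspace (btop B)" "proj B (bscale B c a) = proj B a"
  using complex_banach_space.scale_closed[OF banach_fibre[OF proj_base[OF assms]], of a c] assms
  by simp_all

lemma bnorm_nonneg: "a \<in> topspace (btop B) \<Longrightarrow> 0 \<le> bnorm B a"
  using complex_banach_space.norm_nonneg[OF banach_fibre[OF proj_base], of a a] by simp

text \<open>The net axiom applied to the filter generated by the sets
  \<open>{a. p(a) \<in> U, \<parallel>a\<parallel> < e}\<close> says that these sets form a neighbourhood base at \<open>0\<^sub>x\<close>.\<close>

lemma zero_neighbourhood:
  assumes x: "x \<in> topspace T" and V: "openin (btop B) V" "bzero B x \<in> V"
  shows "\<exists>U e. openin T U \<and> x \<in> U \<and> e > 0 \<and>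
    (\<forall>a\<in>topspace (btop B). proj B a \<in> U \<longrightarrow> bnorm B a < e \<longrightarrow> a \<in> V)"
proof -
  define box where "box = (\<lambda>(U, e). {a \<in> topspace (btop B). proj B a \<in> U \<and> bnorm B a < e})"
  define P where "P = {(U, e :: real). openin T U \<and> x \<in> U \<and> e > 0}"
  define F where "F = (INF p\<in>P. principal (box p))"
  have ne: "P \<noteq> {}"
  proof -
    have "(topspace T, 1) \<in> P" using x by (simp add: P_def)
    then show ?thesis by blast
  qed
  have dir: "\<exists>r\<in>P. principal (box r) \<le> inf (principal (box p)) (principal (box q))"
    if pq: "p \<in> P" "q \<in> P" for p q
  proof -
    obtain U e V d where eq: "p = (U, e)" "q = (V, d)" by (metis surj_pair)
    have "(U \<inter> V, min e d) \<in> P" using pq by (simp add: P_def eq openin_Int)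
    moreover have "principal (box (U \<inter> V, min e d)) \<le> inf (principal (box p)) (principal (box q))"
      by (auto simp: box_def eq)
    ultimately show ?thesis by blast
  qed
  have ev_iff: "eventually Q F \<longleftrightarrow> (\<exists>p\<in>P. \<forall>a\<in>box p. Q a)" for Q
    unfolding F_def by (subst eventually_INF_base[OF ne dir]) (simp_all add: eventually_principal)
  have ev: "eventually Q F" if "openin T U" "x \<in> U" "e > 0"
    "\<And>a. a \<in> topspace (btop B) \<Longrightarrow> proj B a \<in> U \<Longrightarrow> bnorm B a < e \<Longrightarrow> Q a" for Q U e
  proof -
    have "(U, e) \<in> P" "\<forall>a\<in>box (U, e). Q a" using that by (simp_all add: P_def box_def)
    then show ?thesis unfolding ev_iff by blast
  qed
  have "limitin (btop B) (\<lambda>a. a) (bzero B x) F"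
  proof (rule net_to_zero)
    show "\<forall>\<^sub>F a in F. a \<in> topspace (btop B)"
      by (rule ev[of "topspace T" 1]) (use x in auto)
    show "limitin T (proj B) x F"
      unfolding limitin_def using x by (auto intro: ev[of _ 1])
    show "(bnorm B \<longlongrightarrow> 0) F"
    proof (rule tendstoI)
      fix e :: real assume "e > 0"
      then show "\<forall>\<^sub>F a in F. dist (bnorm B a) 0 < e"
        by (intro ev[of "topspace T" e]) (use x bnorm_nonneg in auto)
    qed
  qed
  then have "\<forall>\<^sub>F a in F. a \<in> V" using V unfolding limitin_def by blast
  then obtain U e where Ue: "(U, e) \<in> P" "\<forall>a\<in>box (U, e). a \<in> V"
    unfolding ev_iff by (metis surj_pair)
  then show ?thesis
    by (intro exI[of _ U] exI[of _ e]) (simp add: P_def box_def)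
qed

end

locale free_proper_bundle_action =
  fell_bundle_action X A H TH act bact + free_proper_groupoid_action X H TH act
  for X :: "('x, 'n) groupoid_data_scheme" and A :: "('a, 'x, 'm) fell_data_scheme"
    and H :: "('h, 'k) monoid_scheme" and TH and act :: "'x \<Rightarrow> 'h \<Rightarrow> 'x"
    and bact :: "'a \<Rightarrow> 'h \<Rightarrow> 'a"
begin

abbreviation "XH \<equiv> orbit_groupoid X H act"
abbreviation "AH \<equiv> orbit_bundle X A H bact"

lemma bact_one: assumes "a \<in> topspace (btop A)" shows "bact a \<one>\<^bsub>H\<^esub> = a"
proof -
  have "bact (bact a \<one>\<^bsub>H\<^esub>) \<one>\<^bsub>H\<^esub> = bact a \<one>\<^bsub>H\<^esub>" using assms bact_bact by simp
  moreover have "inj_on (\<lambda>a. bact a \<one>\<^bsub>H\<^esub>) (topspace (btop A))"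
    using bautomorphism[of "\<one>\<^bsub>H\<^esub>"] unfolding fell_automorphism_def by (auto dest: bij_betw_imp_inj_on)
  ultimately show ?thesis using assms bact_props(1)[of a "\<one>\<^bsub>H\<^esub>"] by (auto dest: inj_onD)
qed

sublocale tot: right_action H TH "btop A" bact
  by unfold_locales (fact continuous_bact bact_one bact_bact)+

lemma btop_orbit: "btop AH = tot.quot"
  by (simp add: orbit_bundle_def)

lemma gtop_orbit: "gtop XH = arr.quot"
  by (simp add: orbit_groupoid_def)

lemma elements_orbit [simp]: "topspace (btop AH) = tot.orb ` topspace (btop A)"
  by (simp add: btop_orbit)

lemma orbit_bundle_proj:
  "a \<in> topspace (btop A) \<Longrightarrow> proj AH (tot.orb a) = arr.orb (proj A a)"
  unfolding orbit_bundle_def rorbit_eq by (auto simp: setcompr_eq_image image_image bact_props(2))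

lemma orbit_bundle_bstar:
  "a \<in> topspace (btop A) \<Longrightarrow> bstar AH (tot.orb a) = tot.orb (bstar A a)"
  unfolding orbit_bundle_def rorbit_eq by (auto simp: setcompr_eq_image image_image bact_props(4))

text \<open>The zero vectors are recovered from the scalar multiplication as \<open>0 a\<close>.\<close>

lemma bact_bzero:
  assumes x: "x \<in> arrows X" and h: "h \<in> carrier H"
  shows "bact (bzero A x) h = bzero A (act x h)"
proof -
  have z: "bscale A 0 a = bzero A (proj A a)" if "a \<in> topspace (btop A)" for a
    using complex_banach_space.scale_zero[OF banach_fibre[OF proj_arrow[OF that]], of a] that by simp
  note zx = bzero_closed[OF x]
  have "bact (bzero A x) h = bact (bscale A 0 (bzero A x)) h" using z[OF zx(1)] zx(2) by simp
  also have "\<dots> = bscale A 0 (bact (bzero A x) h)" using bact_props(5)[OF zx(1) h] .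
  also have "\<dots> = bzero A (act x h)"
    using z[OF bact_props(1)[OF zx(1) h]] bact_props(2)[OF zx(1) h] zx(2) by simp
  finally show ?thesis .
qed

lemma orbit_bundle_bzero:
  "x \<in> arrows X \<Longrightarrow> bzero AH (arr.orb x) = tot.orb (bzero A x)"
  unfolding orbit_bundle_def rorbit_eq by (auto simp: setcompr_eq_image image_image bact_bzero)

lemma bsrc_bact:
  assumes "a \<in> topspace (btop A)" "h \<in> carrier H"
  shows "bsrc X A (bact a h) = act (bsrc X A a) h" "brng X A (bact a h) = act (brng X A a) h"
  using assms by (simp_all add: bsrc_def brng_def bact_props act_src act_rng proj_arrow)

lemma bsrc_arrow:
  assumes "a \<in> topspace (btop A)"
  shows "bsrc X A a \<in> arrows X" "brng X A a \<in> arrows X"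
  using assms by (simp_all add: bsrc_def brng_def proj_arrow src_closed rng_closed)

lemma orbit_bundle_bsrc:
  assumes "a \<in> topspace (btop A)"
  shows "bsrc XH AH (tot.orb a) = arr.orb (bsrc X A a)" "brng XH AH (tot.orb a) = arr.orb (brng X A a)"
  using assms by (simp_all add: bsrc_def brng_def orbit_bundle_proj orbit_groupoid_simps proj_arrow)

lemma orbit_bundle_bmult:
  assumes a: "a \<in> topspace (btop A)" and b: "b \<in> topspace (btop A)" and c: "bsrc X A a = brng X A b"
  shows "bmult AH (tot.orb a) (tot.orb b) = tot.orb (bmult A a b)"
proof -
  have "h = k" if "h \<in> carrier H" "k \<in> carrier H" "bsrc X A (bact a h) = brng X A (bact b k)" for h k
    using free_eq[OF free bsrc_arrow(2)[OF b] that(1,2)] that bsrc_bact[OF a] bsrc_bact[OF b] c by simp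
  moreover have "bsrc X A (bact a h) = brng X A (bact b h)" if "h \<in> carrier H" for h
    using that bsrc_bact[OF a] bsrc_bact[OF b] c by simp
  ultimately have "{bmult A a' b' | a' b'. a' \<in> tot.orb a \<and> b' \<in> tot.orb b \<and> bsrc X A a' = brng X A b'}
      = {bmult A (bact a h) (bact b h) | h. h \<in> carrier H}"
    unfolding rorbit_eq by blast
  also have "\<dots> = tot.orb (bmult A a b)"
    unfolding rorbit_eq using bact_bmult[OF a b c] by metis
  finally show ?thesis by (simp add: orbit_bundle_def)
qed

lemmas orbit_bundle_simps = orbit_bundle_proj orbit_bundle_bsrc orbit_bundle_bzero
  orbit_bundle_bnorm orbit_bundle_bscale orbit_bundle_badd[OF free] orbit_bundle_bmult orbit_bundle_bstar

lemma fibre_lift: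
  assumes x: "x \<in> arrows X" and Q: "Q \<in> topspace (btop AH)" and p: "proj AH Q = arr.orb x"
  shows "\<exists>b\<in>topspace (btop A). Q = tot.orb b \<and> proj A b = x"
proof -
  obtain b where b: "b \<in> topspace (btop A)" "Q = tot.orb b" using Q by auto
  then have "arr.orb (proj A b) = arr.orb x" using p by (simp add: orbit_bundle_proj)
  then obtain h where h: "h \<in> carrier H" "x = act (proj A b) h"
    using arr.orb_eqD[OF proj_arrow[OF b(1)] x] by blast
  then show ?thesis
    using b by (intro bexI[of _ "bact b h"]) (simp_all add: bact_props tot.orb_action)
qed

lemma bundle_composable_lift:
  assumes a: "a \<in> topspace (btop A)" and Q: "Q \<in> topspace (btop AH)"
    and c: "bsrc XH AH (tot.orb a) = brng XH AH Q"
  shows "\<exists>b\<in>topspace (btop A). Q = tot.orb b \<and> bsrc X A a = brng X A b"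
proof -
  obtain b where b: "b \<in> topspace (btop A)" "Q = tot.orb b" using Q by auto
  then have "arr.orb (brng X A b) = arr.orb (bsrc X A a)" using c a by (simp add: orbit_bundle_bsrc)
  then obtain h where h: "h \<in> carrier H" "bsrc X A a = act (brng X A b) h"
    using arr.orb_eqD[OF bsrc_arrow(2)[OF b(1)] bsrc_arrow(1)[OF a]] by blast
  then show ?thesis
    using b by (intro bexI[of _ "bact b h"]) (simp_all add: bact_props bsrc_bact tot.orb_action)
qed

text \<open>An orbit meets each fibre over the corresponding orbit of arrows in exactly one point, since
  the action on arrows is free.\<close>

lemma orb_inj_fibre:
  assumes a: "a \<in> topspace (btop A)" and b: "b \<in> topspace (btop A)"
    and "proj A a = proj A b" "tot.orb a = tot.orb b"
  shows "a = b"
proof -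
  obtain h where h: "h \<in> carrier H" "b = bact a h"
    using tot.orb_eqD[OF a b] assms by blast
  then have "act (proj A a) h = proj A a" using assms bact_props(2)[OF a] by simp
  then have "h = \<one>\<^bsub>H\<^esub>" using free h proj_arrow[OF a] unfolding free_action_def by blast
  then show ?thesis using h bact_one[OF a] by simp
qed

lemma bij_orb_fibre:
  assumes "x \<in> arrows X"
  shows "bij_betw tot.orb {a \<in> topspace (btop A). proj A a = x}
    {P \<in> topspace (btop AH). proj AH P = arr.orb x}"
  unfolding bij_betw_def
proof (intro conjI)
  show "inj_on tot.orb {a \<in> topspace (btop A). proj A a = x}"
    by (auto intro!: inj_onI orb_inj_fibre)
  show "tot.orb ` {a \<in> topspace (btop A). proj A a = x}
      = {P \<in> topspace (btop AH). proj AH P = arr.orb x}"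
    using fibre_lift[OF assms] by (auto simp: orbit_bundle_proj)
qed

text \<open>The norm, the linear operations and the zero of an orbit fibre are given by images of
  representatives, hence the orbit map of the total space identifies corresponding fibres.\<close>

lemma fibre_iso:
  assumes x: "x \<in> arrows X"
  shows "normed_iso (fibre A x) (fibre AH (arr.orb x)) tot.orb"
  by unfold_locales
    (use x bij_orb_fibre in \<open>simp_all add: fibre_def orbit_bundle_simps\<close>)

lemma fibre_alg_iso:
  assumes x: "x \<in> arrows X" and u: "src X x = x" "rng X x = x" "ginv X x = x"
  shows "cstar_iso (fibre_alg A x) (fibre_alg AH (arr.orb x)) tot.orb"
  by unfold_locales
    (use x u bij_orb_fibre in \<open>simp_all add: fibre_alg_def orbit_bundle_simps bsrc_def brng_def\<close>)

text \<open>Scalar multiplication has no composability constraint; it descends because the orbit map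
  of the total space is open.\<close>

lemma continuous_orbit_bscale:
  "continuous_map (prod_topology euclidean (btop AH)) (btop AH) (\<lambda>(c, P). bscale AH c P)"
  unfolding continuous_map_eq_topcontinuous_at topcontinuous_at_def
proof (intro ballI conjI allI impI)
  let ?S = "prod_topology euclidean (btop AH)"
  show "(\<lambda>(c, P). bscale AH c P) \<in> topspace ?S \<rightarrow> topspace (btop AH)"
    by (auto simp: orbit_bundle_simps bscale_closed)
  fix p V assume p: "p \<in> topspace ?S" and V: "openin (btop AH) V \<and> (case p of (c, P) \<Rightarrow> bscale AH c P) \<in> V"
  obtain c a where a: "a \<in> topspace (btop A)" "p = (c, tot.orb a)" using p by auto
  let ?V = "{d \<in> topspace (btop A). tot.orb d \<in> V}"
  have "openin (btop A) ?V" using V by (simp add: btop_orbit openin_quotient_topology)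
  from openin_continuous_map_preimage[OF continuous_scale this]
  have "openin (prod_topology euclidean (btop A))
      {q \<in> topspace (prod_topology euclidean (btop A)). (\<lambda>(c, a). bscale A c a) q \<in> ?V}" .
  moreover have "(c, a) \<in> {q \<in> topspace (prod_topology euclidean (btop A)). (\<lambda>(c, a). bscale A c a) q \<in> ?V}"
    using a V by (simp add: orbit_bundle_simps bscale_closed)
  ultimately obtain U1 U2 where U: "openin euclidean U1" "openin (btop A) U2" "c \<in> U1" "a \<in> U2"
    "U1 \<times> U2 \<subseteq> {q \<in> topspace (prod_topology euclidean (btop A)). (\<lambda>(c, a). bscale A c a) q \<in> ?V}"
    by (rule openin_prod_boxE)
  have sub: "U2 \<subseteq> topspace (btop A)" using U(2) by (rule openin_subset)
  have "openin ?S (U1 \<times> tot.orb ` U2)"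
    using U(1,2) tot.open_map_orb by (simp add: openin_prod_Times_iff open_map_def btop_orbit)
  moreover have "p \<in> U1 \<times> tot.orb ` U2" using a U(3,4) by simp
  moreover have "(case q of (c, P) \<Rightarrow> bscale AH c P) \<in> V" if q: "q \<in> U1 \<times> tot.orb ` U2" for q
  proof -
    obtain d b where "d \<in> U1" "b \<in> U2" "q = (d, tot.orb b)" using q by auto
    moreover from this have "(d, b) \<in> U1 \<times> U2" by simp
    then have "tot.orb (bscale A d b) \<in> V" using U(5) by auto
    ultimately show ?thesis using sub by (auto simp: orbit_bundle_bscale)
  qed
  ultimately show "\<exists>U. openin ?S U \<and> p \<in> U \<and> (\<forall>q\<in>U. (case q of (c, P) \<Rightarrow> bscale AH c P) \<in> V)"
    by blast
qed

text \<open>The orbit maps of the arrows and of the total space are open and norms are constant on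
  orbits, so the basic neighbourhoods of \<open>0\<^sub>x\<close> map onto sets of the same kind around the zero over
  \<open>x\<cdot>H\<close>.\<close>

lemma orbit_net_to_zero:
  assumes ev: "\<forall>\<^sub>F P in F. P \<in> topspace (btop AH)"
    and base: "limitin (gtop XH) (proj AH) t F" and norm: "(bnorm AH \<longlongrightarrow> 0) F"
  shows "limitin (btop AH) (\<lambda>P. P) (bzero AH t) F"
proof -
  have "t \<in> arrows XH" using base by (simp add: limitin_def)
  then obtain x where x: "x \<in> arrows X" "t = arr.orb x" by auto
  show ?thesis
    unfolding limitin_def
  proof (intro conjI allI impI)
    show "bzero AH t \<in> topspace (btop AH)" using x by (simp add: orbit_bundle_simps bzero_closed)
    fix V assume V: "openin (btop AH) V \<and> bzero AH t \<in> V"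
    have "openin (btop A) {a \<in> topspace (btop A). tot.orb a \<in> V}"
      using V by (simp add: btop_orbit openin_quotient_topology)
    moreover have "bzero A x \<in> {a \<in> topspace (btop A). tot.orb a \<in> V}"
      using V x by (simp add: orbit_bundle_simps bzero_closed)
    ultimately have "\<exists>U e. openin (gtop X) U \<and> x \<in> U \<and> e > 0 \<and>
      (\<forall>a\<in>topspace (btop A). proj A a \<in> U \<longrightarrow> bnorm A a < e
         \<longrightarrow> a \<in> {a \<in> topspace (btop A). tot.orb a \<in> V})"
      by (rule zero_neighbourhood[OF x(1)])
    then obtain U e where U: "openin (gtop X) U" "x \<in> U" "e > 0"
      "\<forall>a\<in>topspace (btop A). proj A a \<in> U \<longrightarrow> bnorm A a < e
         \<longrightarrow> a \<in> {a \<in> topspace (btop A). tot.orb a \<in> V}"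
      by blast
    have "openin (gtop XH) (arr.orb ` U)"
      using arr.open_map_orb U(1) by (simp add: open_map_def gtop_orbit)
    then have "\<forall>\<^sub>F P in F. proj AH P \<in> arr.orb ` U"
      using base x U(2) unfolding limitin_def by blast
    moreover have "\<forall>\<^sub>F P in F. bnorm AH P < e"
      using norm U(3) by (rule order_tendstoD(2))
    ultimately show "\<forall>\<^sub>F P in F. P \<in> V"
      using ev
    proof eventually_elim
      fix P assume P: "proj AH P \<in> arr.orb ` U" "bnorm AH P < e" "P \<in> topspace (btop AH)"
      then obtain y where y: "y \<in> U" "proj AH P = arr.orb y" by blast
      then have "y \<in> arrows X" using U(1) openin_subset by blast
      then obtain b where "b \<in> topspace (btop A)" "P = tot.orb b" "proj A b = y"
        using fibre_lift[OF _ P(3) y(2)] by blast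
      then show "P \<in> V" using U(4) P(2) y(1) by (simp add: orbit_bundle_bnorm)
    qed
  qed
qed

lemma open_orbit_proj: "open_map (btop AH) (gtop XH) (proj AH)"
  unfolding open_map_def
proof (intro allI impI)
  fix V assume V: "openin (btop AH) V"
  let ?V = "{a \<in> topspace (btop A). tot.orb a \<in> V}"
  have "openin (btop A) ?V" using V by (simp add: btop_orbit openin_quotient_topology)
  then have "openin (gtop XH) (arr.orb ` proj A ` ?V)"
    using open_proj arr.open_map_orb by (simp add: open_map_def gtop_orbit)
  moreover have "proj AH ` V = arr.orb ` proj A ` ?V"
    using openin_subset[OF V] by (force simp: orbit_bundle_proj)
  ultimately show "openin (gtop XH) (proj AH ` V)" by simp
qed

lemma continuous_orbit_badd:
  "continuous_map (subtopology (prod_topology (btop AH) (btop AH)) {(P, Q). proj AH P = proj AH Q})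
     (btop AH) (\<lambda>(P, Q). badd AH P Q)"
  unfolding btop_orbit
proof (rule continuous_map_orbit_operation[OF _ _ _ _ continuous_proj continuous_proj _ continuous_add])
  show "principal_action H TH (gtop X) act" by (rule arr.principal_action_axioms)
qed (simp_all add: tot.right_action_axioms bact_props orbit_bundle_simps)

lemma continuous_bsrc:
  "continuous_map (btop A) (gtop X) (bsrc X A)" "continuous_map (btop A) (gtop X) (brng X A)"
  using continuous_map_compose[OF continuous_proj continuous_src]
    continuous_map_compose[OF continuous_proj continuous_rng]
  by (simp_all add: bsrc_def[abs_def] brng_def[abs_def] o_def)

lemma continuous_orbit_bmult:
  "continuous_map (subtopology (prod_topology (btop AH) (btop AH)) {(P, Q). bsrc XH AH P = brng XH AH Q})
     (btop AH) (\<lambda>(P, Q). bmult AH P Q)"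
  unfolding btop_orbit
proof (rule continuous_map_orbit_operation[OF _ _ _ _ continuous_bsrc _ continuous_bmult])
  show "principal_action H TH (gtop X) act" by (rule arr.principal_action_axioms)
qed (simp_all add: tot.right_action_axioms bsrc_bact orbit_bundle_simps)

lemma orbit_usc_norm: "openin (btop AH) {P \<in> topspace (btop AH). bnorm AH P < c}"
proof -
  have "{a \<in> topspace (btop A). tot.orb a \<in> {P \<in> topspace (btop AH). bnorm AH P < c}}
      = {a \<in> topspace (btop A). bnorm A a < c}"
    by (auto simp: orbit_bundle_bnorm)
  then show ?thesis
    using usc_norm[of c] by (auto simp: btop_orbit openin_quotient_topology)
qed

end

section \<open>Separability of the sections of the orbit bundle\<close>

text \<open>A second countable locally compact space is covered by countably many open sets with compact
  supersets \<open>k U\<close>; the family sought consists of the finite unions of these.  As \<open>q\<close> is open, the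
  images of the open sets cover every compact subset of \<open>S\<close> by finitely many of them.\<close>

lemma countable_compact_exhaustion:
  assumes T: "lchs_space T" and cont: "continuous_map T S q" and op: "open_map T S q"
    and surj: "q ` topspace T = topspace S"
  shows "\<exists>\<K>. countable \<K> \<and> (\<forall>K\<in>\<K>. compactin T K) \<and>
    (\<forall>C. compactin S C \<longrightarrow> (\<exists>K\<in>\<K>. C \<subseteq> q ` K))"
proof -
  let ?\<U> = "{U. openin T U \<and> (\<exists>K. compactin T K \<and> U \<subseteq> K)}"
  have "Lindelof_space T" using T by (simp add: lchs_space_def second_countable_imp_Lindelof_space)
  moreover have "topspace T \<subseteq> \<Union>?\<U>"
    using T unfolding lchs_space_def locally_compact_space_def by blast
  ultimately have "\<exists>\<V>. countable \<V> \<and> \<V> \<subseteq> ?\<U> \<and> topspace T \<subseteq> \<Union>\<V>"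
    unfolding Lindelof_space_alt by (elim allE[of _ ?\<U>] impE) auto
  then obtain \<V> where \<V>: "countable \<V>" "\<V> \<subseteq> ?\<U>" "topspace T \<subseteq> \<Union>\<V>"
    by blast
  have "\<forall>U\<in>\<V>. \<exists>K. compactin T K \<and> U \<subseteq> K" using \<V>(2) by blast
  then obtain k where k: "\<And>U. U \<in> \<V> \<Longrightarrow> compactin T (k U) \<and> U \<subseteq> k U"
    by (auto dest!: bchoice)
  define \<K> where "\<K> = (\<lambda>\<F>. \<Union> (k ` \<F>)) ` {\<F>. finite \<F> \<and> \<F> \<subseteq> \<V>}"
  show ?thesis
  proof (intro exI[of _ \<K>] conjI ballI allI impI)
    show "countable \<K>"
      unfolding \<K>_def using countable_Collect_finite_subset[OF \<V>(1)] by (rule countable_image)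
    show "compactin T K" if "K \<in> \<K>" for K
    proof -
      obtain \<F> where "finite \<F>" "\<F> \<subseteq> \<V>" "K = \<Union> (k ` \<F>)"
        using \<open>K \<in> \<K>\<close> unfolding \<K>_def by blast
      then show ?thesis using k by (simp only:) (rule compactin_Union, auto)
    qed
    fix C assume C: "compactin S C"
    have "openin S U" if "U \<in> (`) q ` \<V>" for U using that op \<V>(2) unfolding open_map_def by blast
    moreover have "C \<subseteq> \<Union>((`) q ` \<V>)"
    proof -
      have "C \<subseteq> q ` topspace T" using compactin_subset_topspace[OF C] surj by simp
      also have "\<dots> \<subseteq> q ` \<Union>\<V>" using \<V>(3) by (rule image_mono)
      finally show ?thesis by blast
    qed
    ultimately have "\<exists>\<F>. finite \<F> \<and> \<F> \<subseteq> (`) q ` \<V> \<and> C \<subseteq> \<Union>\<F>"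
      by (rule compactinD[OF C])
    then obtain \<F> where \<F>: "finite \<F>" "\<F> \<subseteq> (`) q ` \<V>" "C \<subseteq> \<Union>\<F>"
      by blast
    then obtain \<G> where \<G>: "finite \<G>" "\<G> \<subseteq> \<V>" "\<F> = (`) q ` \<G>"
      using finite_subset_image by metis
    have "q ` U \<subseteq> q ` \<Union> (k ` \<G>)" if "U \<in> \<G>" for U
      using k[of U] \<G>(2) that by blast
    then have "\<Union>\<F> \<subseteq> q ` \<Union> (k ` \<G>)" unfolding \<G>(3) by (rule UN_least)
    with \<F>(3) have "C \<subseteq> q ` \<Union> (k ` \<G>)" by (rule subset_trans)
    moreover have "\<Union> (k ` \<G>) \<in> \<K>" using \<G> unfolding \<K>_def by blast
    ultimately show "\<exists>K\<in>\<K>. C \<subseteq> q ` K" by blast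
  qed
qed

lemma compact_cutoff_function:
  assumes T: "lchs_space T" and K: "compactin T K"
  shows "\<exists>\<phi>. continuous_map T euclideanreal \<phi> \<and> (\<forall>x\<in>K. \<phi> x = 1) \<and>
    (\<exists>L. compactin T L \<and> (\<forall>x\<in>topspace T - L. \<phi> x = 0))"
proof -
  have lc: "locally_compact_space T" "Hausdorff_space T" using T by (simp_all add: lchs_space_def)
  then obtain U L where UL: "openin T U" "compactin T L" "K \<subseteq> U" "U \<subseteq> L"
    using K locally_compact_space_compact_closed_compact[of T] by metis
  have "completely_regular_space T"
    using lc locally_compact_regular_imp_completely_regular_space locally_compact_Hausdorff_or_regular
    by blast
  moreover have "disjnt (topspace T - U) K" using UL(3) by (auto simp: disjnt_def)
  ultimately obtain f where f: "continuous_map T (top_of_set {0..1::real}) f"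
    "f ` K \<subseteq> {0}" "f ` (topspace T - U) \<subseteq> {1}"
    using Urysohn_completely_regular_closed_compact[of 0 1 T "topspace T - U" K] K UL(1)
    by (metis closedin_diff closedin_topspace zero_le_one)
  have "continuous_map T euclideanreal (\<lambda>x. 1 - f x)"
    using f(1) by (intro continuous_map_diff) (auto simp: continuous_map_in_subtopology)
  moreover have "1 - f x = 1" if "x \<in> K" for x using f(2) that by (simp add: image_subset_iff)
  moreover have "1 - f x = 0" if "x \<in> topspace T - L" for x
  proof -
    have "x \<in> topspace T - U" using that UL(4) by blast
    then show ?thesis using f(3) by (simp add: image_subset_iff)
  qed
  ultimately show ?thesis using UL(2) by blast
qed

context banach_bundle
begin

abbreviation bdist :: "'a \<Rightarrow> 'a \<Rightarrow> real" where
  "bdist a b \<equiv> bnorm B (badd B a (bscale B (- 1) b))"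

lemma bdist_eq_vdist:
  assumes "a \<in> topspace (btop B)" "b \<in> topspace (btop B)" "proj B a = proj B b"
  shows "bdist a b = vdist (fibre B (proj B b)) a b"
  using assms by (simp add: vdist_def)

lemma bdist_commute:
  assumes "a \<in> topspace (btop B)" "b \<in> topspace (btop B)" "proj B a = proj B b"
  shows "bdist a b = bdist b a"
proof -
  interpret Metric_space "vcarrier (fibre B (proj B b))" "vdist (fibre B (proj B b))"
    using assms by (intro complex_banach_space.Metric_space_vdist banach_fibre proj_base)
  show ?thesis using assms commute by (simp add: bdist_eq_vdist)
qed

lemma bdist_triangle:
  assumes "a \<in> topspace (btop B)" "b \<in> topspace (btop B)" "d \<in> topspace (btop B)"
    "proj B a = proj B b" "proj B b = proj B d"
  shows "bdist a d \<le> bdist a b + bdist b d"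
proof -
  interpret Metric_space "vcarrier (fibre B (proj B d))" "vdist (fibre B (proj B d))"
    using assms by (intro complex_banach_space.Metric_space_vdist banach_fibre proj_base)
  show ?thesis using assms triangle[of a b d] by (simp add: bdist_eq_vdist)
qed

lemma bdist_le_norms:
  assumes "a \<in> topspace (btop B)" "b \<in> topspace (btop B)" "proj B a = proj B b"
  shows "bdist a b \<le> bnorm B a + bnorm B b"
proof -
  interpret complex_banach_space "fibre B (proj B b)" using assms by (intro banach_fibre proj_base)
  show ?thesis
    using assms norm_triangle[of a "bscale B (- 1) b"] norm_scale[of b "- 1"] bscale_closed[of b]
    by simp
qed

text \<open>The set where the norm is at least \<open>e\<close> is closed by upper semicontinuity of the norm, and
  it is contained in the compact set \<open>L\<close>.\<close>

lemma cutoff_section: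
  assumes f: "continuous_map T (btop B) f" "\<And>x. x \<in> topspace T \<Longrightarrow> proj B (f x) = x"
    and \<phi>: "continuous_map T euclideanreal \<phi>"
    and L: "compactin T L" "\<And>x. x \<in> topspace T - L \<Longrightarrow> \<phi> x = 0"
  shows "(\<lambda>x. bscale B (complex_of_real (\<phi> x)) (f x)) \<in> c0_sections T B"
proof -
  let ?g = "\<lambda>x. bscale B (complex_of_real (\<phi> x)) (f x)"
  have fB: "f x \<in> topspace (btop B)" if "x \<in> topspace T" for x
    using funcset_mem[OF continuous_map_funspace[OF f(1)] that] .
  have "continuous_map T euclidean (\<lambda>x. complex_of_real (\<phi> x))"
    using continuous_map_compose[OF \<phi>, of euclidean complex_of_real]
    by (simp add: o_def continuous_on_of_real)
  then have "continuous_map T (prod_topology euclidean (btop B)) (\<lambda>x. (complex_of_real (\<phi> x), f x))"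
    using f(1) by (rule continuous_map_pairedI)
  from continuous_map_compose[OF this continuous_scale] have g: "continuous_map T (btop B) ?g"
    by (simp add: o_def)
  have "compactin T {x \<in> topspace T. e \<le> bnorm B (?g x)}" if e: "e > 0" for e
  proof (rule closed_compactin[OF L(1)])
    have "bnorm B (?g x) = 0" if x: "x \<in> topspace T - L" for x
    proof -
      interpret complex_banach_space "fibre B x" using x by (intro banach_fibre) simp
      show ?thesis using norm_scale[of "f x" 0] x fB f(2) L(2) by simp
    qed
    then show "{x \<in> topspace T. e \<le> bnorm B (?g x)} \<subseteq> L" using e by force
    have "openin T {x \<in> topspace T. ?g x \<in> {a \<in> topspace (btop B). bnorm B a < e}}"
      by (rule openin_continuous_map_preimage[OF g usc_norm])
    moreover have "{x \<in> topspace T. ?g x \<in> {a \<in> topspace (btop B). bnorm B a < e}}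
        = topspace T - {x \<in> topspace T. e \<le> bnorm B (?g x)}"
      using fB bscale_closed(1) by force
    ultimately show "closedin T {x \<in> topspace T. e \<le> bnorm B (?g x)}"
      by (simp add: closedin_def)
  qed
  then show ?thesis
    using g f(2) fB by (simp add: c0_sections_def bscale_closed)
qed

end

text \<open>The total space is the pullback of its orbit space along the orbit map of the base.  Near
  \<open>f z\<close>, the orbit of \<open>f y\<close> has a representative \<open>b\<close> close to \<open>f z\<close>, say \<open>f y = b\<cdot>h\<close>; both \<open>p b\<close>
  and \<open>p (f y)\<close> are close to \<open>p (f z)\<close>, so \<open>h\<close> is close to the identity.\<close>

lemma continuous_map_into_pullback:
  assumes 1: "right_action H TH T1 act1" and base: "principal_action H TH T act"
    and p: "continuous_map T1 T p"
    and p_act: "\<And>a h. a \<in> topspace T1 \<Longrightarrow> h \<in> carrier H \<Longrightarrow> p (act1 a h) = act (p a) h"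
    and s: "continuous_map Z T (\<lambda>z. p (f z))"
    and F: "continuous_map Z (quotient_topology T1 (rorbit H act1)) (\<lambda>z. rorbit H act1 (f z))"
    and f: "\<And>z. z \<in> topspace Z \<Longrightarrow> f z \<in> topspace T1"
  shows "continuous_map Z T1 f"
proof -
  interpret A1: right_action H TH T1 act1 by (rule 1)
  interpret B: principal_action H TH T act by (rule base)
  show ?thesis
    unfolding continuous_map_eq_topcontinuous_at topcontinuous_at_def
  proof (intro ballI conjI allI impI)
    show "f \<in> topspace Z \<rightarrow> topspace T1" using f by blast
    fix z V assume z: "z \<in> topspace Z" and V: "openin T1 V \<and> f z \<in> V"
    have pz: "p (f z) \<in> topspace T" using funcset_mem[OF continuous_map_funspace[OF s] z] .
    obtain W N where W: "openin T1 W" "f z \<in> W" "openin TH N" "\<one>\<^bsub>H\<^esub> \<in> N"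
      "\<And>a h. a \<in> W \<Longrightarrow> h \<in> N \<Longrightarrow> act1 a h \<in> V"
      using A1.action_nhd[OF f[OF z]] V by blast
    obtain U where U: "openin T U" "p (f z) \<in> U"
      "\<And>y h. y \<in> U \<Longrightarrow> h \<in> carrier H \<Longrightarrow> act y h \<in> U \<Longrightarrow> h \<in> N"
      using B.small_translations[OF pz W(3,4)] by blast
    let ?W = "W \<inter> {a \<in> topspace T1. p a \<in> U}"
    have "openin T1 ?W" using W(1) openin_continuous_map_preimage[OF p U(1)] by (rule openin_Int)
    then have "openin A1.quot (A1.orb ` ?W)" using A1.open_map_orb by (simp add: open_map_def)
    from openin_continuous_map_preimage[OF F this] openin_continuous_map_preimage[OF s U(1)]
    have "openin Z ({z \<in> topspace Z. A1.orb (f z) \<in> A1.orb ` ?W} \<inter> {z \<in> topspace Z. p (f z) \<in> U})"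
      (is "openin Z ?R")
      by (rule openin_Int)
    moreover have "z \<in> ?R" using z W(2) U(2) f by blast
    moreover have "f y \<in> V" if y: "y \<in> ?R" for y
    proof -
      obtain b where b: "b \<in> ?W" "A1.orb (f y) = A1.orb b" using y by blast
      have yZ: "y \<in> topspace Z" using y by simp
      have bT: "b \<in> topspace T1" using b by simp
      obtain h where h: "h \<in> carrier H" "f y = act1 b h"
        using A1.orb_eqD[OF bT f[OF yZ]] b(2) by auto
      have "h \<in> N" using U(3)[of "p b" h] b y h p_act[OF bT h(1)] by simp
      then show ?thesis using W(5) b h by simp
    qed
    ultimately show "\<exists>R. openin Z R \<and> z \<in> R \<and> (\<forall>y\<in>R. f y \<in> V)" by blast
  qed
qed

context free_proper_bundle_action
begin

text \<open>The equivariant section of the given bundle that corresponds to a section of the orbit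
  bundle: its value at \<open>x\<close> is the only point of the orbit \<open>F (x\<cdot>H)\<close> in the fibre over \<open>x\<close>.\<close>

definition lift_section :: "('x set \<Rightarrow> 'a set) \<Rightarrow> 'x \<Rightarrow> 'a" where
  "lift_section F x = (SOME a. a \<in> topspace (btop A) \<and> proj A a = x \<and> tot.orb a = F (arr.orb x))"

lemma lift_section:
  assumes F: "F \<in> c0_sections (gtop XH) AH" and x: "x \<in> arrows X"
  shows "lift_section F x \<in> topspace (btop A)" "proj A (lift_section F x) = x"
    "F (arr.orb x) = tot.orb (lift_section F x)"
proof -
  have t: "arr.orb x \<in> arrows XH" using x by simp
  have "F (arr.orb x) \<in> topspace (btop AH)" "proj AH (F (arr.orb x)) = arr.orb x"
    using F t x funcset_mem[OF continuous_map_funspace, of "gtop XH" "btop AH" F "arr.orb x"]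
    by (simp_all add: c0_sections_def)
  then have "\<exists>a. a \<in> topspace (btop A) \<and> proj A a = x \<and> tot.orb a = F (arr.orb x)"
    using fibre_lift[OF x] by metis
  from someI_ex[OF this] show "lift_section F x \<in> topspace (btop A)" "proj A (lift_section F x) = x"
    "F (arr.orb x) = tot.orb (lift_section F x)"
    unfolding lift_section_def by simp_all
qed

lemma continuous_lift_section:
  assumes F: "F \<in> c0_sections (gtop XH) AH"
  shows "continuous_map (gtop X) (btop A) (lift_section F)"
proof (rule continuous_map_into_pullback[OF tot.right_action_axioms arr.principal_action_axioms
      continuous_proj])
  show "continuous_map (gtop X) (gtop X) (\<lambda>x. proj A (lift_section F x))"
    by (rule continuous_map_eq[OF continuous_map_id]) (simp add: lift_section[OF F])
  have "continuous_map (gtop XH) (btop AH) F" using F by (simp add: c0_sections_def)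
  then have "continuous_map (gtop X) tot.quot (F \<circ> arr.orb)"
    unfolding gtop_orbit btop_orbit by (rule continuous_map_compose[OF arr.continuous_orb])
  then show "continuous_map (gtop X) tot.quot (\<lambda>x. tot.orb (lift_section F x))"
    by (rule continuous_map_eq) (simp add: lift_section[OF F])
qed (simp_all add: bact_props lift_section[OF F])

lemma orbit_sections_dist:
  assumes "F \<in> c0_sections (gtop XH) AH" "G \<in> c0_sections (gtop XH) AH" "x \<in> arrows X"
  shows "bnorm AH (badd AH (F (arr.orb x)) (bscale AH (- 1) (G (arr.orb x))))
    = bdist (lift_section F x) (lift_section G x)"
  using assms(3) lift_section[OF assms(1,3)] lift_section[OF assms(2,3)]
  by (simp add: orbit_bundle_simps bscale_closed badd_closed)

text \<open>For each dense section \<open>d\<close>, each \<open>K\<close> and each bound \<open>r n\<close>, choose one section \<open>F\<close>, if there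
  is any, that is smaller than \<open>r n\<close> off the image of \<open>K\<close> and whose cut-off lift is within \<open>r n\<close> of
  \<open>d\<close>.  Two sections that meet these requirements for the same \<open>d\<close>, \<open>K\<close> and \<open>n\<close> differ by less than
  \<open>2 * r n\<close> everywhere: on the image of \<open>K\<close> through \<open>d\<close>, elsewhere because both are small.\<close>

lemma orbit_separable:
  "\<exists>D. countable D \<and> D \<subseteq> c0_sections (gtop XH) AH \<and>
     (\<forall>F \<in> c0_sections (gtop XH) AH. \<forall>e > 0. \<exists>G \<in> D. \<forall>t \<in> arrows XH.
        bnorm AH (badd AH (F t) (bscale AH (- 1) (G t))) < e)"
proof -
  let ?S = "c0_sections (gtop XH) AH"
  obtain D0 where D0: "countable D0" "D0 \<subseteq> c0_sections (gtop X) A"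
    "\<forall>f\<in>c0_sections (gtop X) A. \<forall>e>0. \<exists>g\<in>D0. \<forall>x\<in>arrows X. bdist (f x) (g x) < e"
    using separable by (elim exE conjE)
  have "arr.orb ` arrows X = topspace arr.quot" by simp
  from countable_compact_exhaustion[OF lchs arr.continuous_orb arr.open_map_orb this]
  obtain \<K> where \<K>: "countable \<K>" "\<And>K. K \<in> \<K> \<Longrightarrow> compactin (gtop X) K"
    "\<And>C. compactin arr.quot C \<Longrightarrow> \<exists>K\<in>\<K>. C \<subseteq> arr.orb ` K"
    by blast
  have "\<forall>K\<in>\<K>. \<exists>\<phi>. continuous_map (gtop X) euclideanreal \<phi> \<and> (\<forall>x\<in>K. \<phi> x = 1) \<and>
    (\<exists>L. compactin (gtop X) L \<and> (\<forall>x\<in>arrows X - L. \<phi> x = 0))"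
    using compact_cutoff_function[OF lchs \<K>(2)] by blast
  then obtain \<phi> where \<phi>: "\<And>K. K \<in> \<K> \<Longrightarrow> continuous_map (gtop X) euclideanreal (\<phi> K)"
    "\<And>K x. K \<in> \<K> \<Longrightarrow> x \<in> K \<Longrightarrow> \<phi> K x = 1"
    "\<And>K. K \<in> \<K> \<Longrightarrow> \<exists>L. compactin (gtop X) L \<and> (\<forall>x\<in>arrows X - L. \<phi> K x = 0)"
    by metis
  \<comment> \<open>The lift of \<open>F\<close>, cut off to a section vanishing at infinity; unchanged on \<open>K\<close>.\<close>
  define \<Phi> where "\<Phi> K F x = bscale A (complex_of_real (\<phi> K x)) (lift_section F x)" for K F x
  define r where "r n = inverse (real (Suc n))" for n
  define good where "good = (\<lambda>(d, K, n) F. F \<in> ?S \<and>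
    (\<forall>t\<in>arrows XH - arr.orb ` K. bnorm AH (F t) < r n) \<and>
    (\<forall>x\<in>arrows X. bdist (\<Phi> K F x) (d x) < r n))"
  have good_S: "F \<in> ?S" if "good i F" for i F
    using that unfolding good_def by (cases i) simp
  have good_iff: "good (d, K, n) F \<longleftrightarrow> F \<in> ?S \<and>
    (\<forall>t\<in>arrows XH - arr.orb ` K. bnorm AH (F t) < r n) \<and>
    (\<forall>x\<in>arrows X. bdist (\<Phi> K F x) (d x) < r n)" for d K n F
    unfolding good_def by (simp only: prod.case)
  define I where "I = {i \<in> D0 \<times> \<K> \<times> UNIV. \<exists>F. good i F}"
  have some: "good i (SOME F. good i F)" if "i \<in> I" for i
  proof -
    have "\<exists>F. good i F" using that unfolding I_def by blast
    then show ?thesis by (rule someI_ex)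
  qed
  show ?thesis
  proof (intro exI[of _ "(\<lambda>i. SOME F. good i F) ` I"] conjI ballI allI impI)
    have "countable (D0 \<times> \<K> \<times> (UNIV :: nat set))" using D0(1) \<K>(1) by simp
    moreover have "I \<subseteq> D0 \<times> \<K> \<times> UNIV" unfolding I_def by (rule Collect_restrict)
    ultimately have "countable I" by (rule countable_subset[rotated])
    then show "countable ((\<lambda>i. SOME F. good i F) ` I)" by (rule countable_image)
    show "(\<lambda>i. SOME F. good i F) ` I \<subseteq> ?S"
      using good_S[OF some] by (rule image_subsetI)
    fix F and e :: real assume F: "F \<in> ?S" and e: "e > 0"
    obtain n where n: "r n < e / 2" unfolding r_def using reals_Archimedean[of "e / 2"] e by auto
    have rn: "r n > 0" by (simp add: r_def)
    have "compactin (gtop XH) {t \<in> arrows XH. r n \<le> bnorm AH (F t)}"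
      using F rn unfolding c0_sections_def by blast
    then obtain K where K: "K \<in> \<K>" "{t \<in> arrows XH. r n \<le> bnorm AH (F t)} \<subseteq> arr.orb ` K"
      using \<K>(3) unfolding gtop_orbit by blast
    have "\<Phi> K F \<in> c0_sections (gtop X) A"
      using \<phi>(3)[OF K(1)] cutoff_section[OF continuous_lift_section[OF F] lift_section(2)[OF F] \<phi>(1)[OF K(1)]]
      unfolding \<Phi>_def[abs_def] by blast
    then obtain d where d: "d \<in> D0" "\<forall>x\<in>arrows X. bdist (\<Phi> K F x) (d x) < r n"
      using D0(3) rn by blast
    have goodF: "good (d, K, n) F" unfolding good_iff
    proof (intro conjI F d(2) ballI)
      fix t assume t: "t \<in> arrows XH - arr.orb ` K"
      show "bnorm AH (F t) < r n"
      proof (rule ccontr)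
        assume "\<not> bnorm AH (F t) < r n"
        then have "t \<in> {t \<in> arrows XH. r n \<le> bnorm AH (F t)}"
          using DiffD1[OF t] by (intro CollectI conjI) (simp_all only: not_less)
        then have "t \<in> arr.orb ` K" by (rule subsetD[OF K(2)])
        with t show False by blast
      qed
    qed
    from exI[where P = "good (d, K, n)", OF this]
    have "\<exists>F. good (d, K, n) F" .
    with d(1) K(1) have i: "(d, K, n) \<in> I" unfolding I_def by simp
    define G where "G = (SOME F. good (d, K, n) F)"
    have goodG: "good (d, K, n) G" using some[OF i] by (simp add: G_def)
    then have G: "G \<in> ?S" by (rule good_S)
    have "bnorm AH (badd AH (F t) (bscale AH (- 1) (G t))) < e" if t: "t \<in> arrows XH" for t
    proof (cases "t \<in> arr.orb ` K")
      case True
      then obtain x where x: "x \<in> K" "t = arr.orb x" by blast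
      have xX: "x \<in> arrows X" using compactin_subset_topspace[OF \<K>(2)[OF K(1)]] x(1) by (rule subsetD)
      have one: "\<Phi> K E x = lift_section E x" if E: "E \<in> ?S" for E
      proof -
        interpret complex_banach_space "fibre A x" by (rule banach_fibre[OF xX])
        show ?thesis
          using scale_one[of "lift_section E x"] lift_section[OF E xX] \<phi>(2)[OF K(1) x(1)]
          by (simp add: \<Phi>_def)
      qed
      have dx: "d x \<in> topspace (btop A)" "proj A (d x) = x"
        using d(1) D0(2) xX funcset_mem[OF continuous_map_funspace, of "gtop X" "btop A" d x]
        by (auto simp: c0_sections_def)
      have "bdist (lift_section F x) (lift_section G x)
          \<le> bdist (lift_section F x) (d x) + bdist (d x) (lift_section G x)"
        by (rule bdist_triangle) (use lift_section[OF F xX] lift_section[OF G xX] dx in simp_all)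
      moreover have "bdist (lift_section F x) (d x) < r n"
        using goodF xX one[OF F] unfolding good_iff by metis
      moreover have "bdist (d x) (lift_section G x) < r n"
        using goodG xX one[OF G] bdist_commute[of "d x" "lift_section G x"] lift_section[OF G xX] dx
        unfolding good_iff by metis
      ultimately show ?thesis using n x(2) orbit_sections_dist[OF F G xX] by simp
    next
      case False
      obtain x where x: "x \<in> arrows X" "t = arr.orb x" using t by auto
      have "bnorm AH (F t) < r n" "bnorm AH (G t) < r n"
        using goodF goodG t False unfolding good_iff by (metis DiffI)+
      then have "bnorm A (lift_section F x) < r n" "bnorm A (lift_section G x) < r n"
        using x by (simp_all add: lift_section[OF F x(1)] lift_section[OF G x(1)] orbit_bundle_bnorm)
      moreover have "bdist (lift_section F x) (lift_section G x)
          \<le> bnorm A (lift_section F x) + bnorm A (lift_section G x)"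
        by (rule bdist_le_norms) (use lift_section[OF F x(1)] lift_section[OF G x(1)] in simp_all)
      ultimately show ?thesis using n x(2) orbit_sections_dist[OF F G x(1)] by simp
    qed
    moreover have "G \<in> (\<lambda>i. SOME F. good i F) ` I" unfolding G_def using i by (rule imageI)
    ultimately show "\<exists>G\<in>(\<lambda>i. SOME F. good i F) ` I. \<forall>t\<in>arrows XH.
        bnorm AH (badd AH (F t) (bscale AH (- 1) (G t))) < e"
      by blast
  qed
qed

section \<open>The orbit bundle as a Fell bundle\<close>

theorem banach_bundle_orbit_bundle: "banach_bundle (gtop XH) AH"
proof (rule banach_bundle.intro)
  show "lchs_space (gtop XH)" using lc_groupoid.lchs[OF lc_groupoid_orbit_groupoid] .
  show "continuous_map (btop AH) (gtop XH) (proj AH)"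
    unfolding btop_orbit gtop_orbit
    by (rule continuous_map_orbit[OF tot.right_action_axioms arr.right_action_axioms continuous_proj
          orbit_bundle_proj])
  have "proj AH ` topspace (btop AH) = arr.orb ` proj A ` topspace (btop A)"
    by (force simp: orbit_bundle_proj)
  then show "proj AH ` topspace (btop AH) = topspace (gtop XH)"
    by (simp add: surj_proj)
  show "complex_banach_space (fibre AH t)" if t: "t \<in> topspace (gtop XH)" for t
  proof -
    obtain x where x: "x \<in> arrows X" "t = arr.orb x" using t by auto
    then show ?thesis
      using normed_iso.complex_banach_space_iso[OF fibre_iso banach_fibre] by blast
  qed
qed (fact open_orbit_proj orbit_usc_norm continuous_orbit_badd continuous_orbit_bscale
    orbit_net_to_zero orbit_separable)+

lemma unit_ginv: "u \<in> units X \<Longrightarrow> rng X u = u \<and> src X u = u \<and> ginv X u = u"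
proof -
  assume "u \<in> units X"
  then have u: "u \<in> arrows X" "rng X u = u" "src X u = u"
    unfolding units_def by (auto simp: rng_closed rng_rng src_rng)
  moreover have "u = ginv X u"
    by (rule ginv_unique) (use u rng_gmult_left[OF u(1)] in simp_all)
  ultimately show ?thesis by simp
qed

lemma orbit_unit_fibre_iso:
  "u \<in> units X \<Longrightarrow> cstar_iso (fibre_alg A u) (fibre_alg AH (arr.orb u)) tot.orb"
  by (rule fibre_alg_iso) (simp_all add: unit_arrow unit_ginv)

text \<open>The orbit map of the total space is an isomorphism on the fibre over \<open>x\<close> and on the two
  coefficient algebras over \<open>r(x)\<close> and \<open>s(x)\<close>, and it respects the products and the
  involution, hence both actions and both inner products.\<close>

lemma orbit_imprimitivity:
  assumes t: "t \<in> arrows XH"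
  shows "imprimitivity_bimodule (fibre_alg AH (rng XH t)) (fibre_alg AH (src XH t)) (fibre AH t)
    (bmult AH) (bmult AH) (\<lambda>P Q. bmult AH P (bstar AH Q)) (\<lambda>P Q. bmult AH (bstar AH P) Q)"
proof -
  obtain x where x: "x \<in> arrows X" "t = arr.orb x" using t by auto
  have un: "rng X x \<in> units X" "src X x \<in> units X"
    unfolding units_def using x(1) rng_ginv[OF x(1)] ginv_closed[OF x(1)] by (blast, metis image_eqI)
  interpret L: cstar_iso "fibre_alg A (rng X x)" "fibre_alg AH (arr.orb (rng X x))" tot.orb
    by (rule orbit_unit_fibre_iso[OF un(1)])
  interpret R: cstar_iso "fibre_alg A (src X x)" "fibre_alg AH (arr.orb (src X x))" tot.orb
    by (rule orbit_unit_fibre_iso[OF un(2)])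
  interpret M: normed_iso "fibre A x" "fibre AH (arr.orb x)" tot.orb by (rule fibre_iso[OF x(1)])
  have "bimodule_iso (fibre_alg A (rng X x)) (fibre_alg AH (arr.orb (rng X x))) tot.orb
      (fibre_alg A (src X x)) (fibre_alg AH (arr.orb (src X x))) tot.orb
      (fibre A x) (fibre AH (arr.orb x)) tot.orb
      (bmult A) (bmult A) (\<lambda>a b. bmult A a (bstar A b)) (\<lambda>a b. bmult A (bstar A a) b)
      (bmult AH) (bmult AH) (\<lambda>P Q. bmult AH P (bstar AH Q)) (\<lambda>P Q. bmult AH (bstar AH P) Q)"
    by unfold_locales
      (use x(1) in \<open>auto simp: fibre_alg_def fibre_def orbit_bundle_simps bsrc_def brng_def
        bstar_closed proj_bstar rng_ginv src_ginv src_rng rng_src\<close>)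
  from bimodule_iso.imprimitivity_bimodule_iso[OF this imprimitivity[OF x(1)]]
  show ?thesis using x by (simp add: orbit_groupoid_simps)
qed

text \<open>As for the groupoid, composable elements are lifted from left to right, and summable ones
  to the same fibre.\<close>

theorem fell_bundle_orbit_bundle: "fell_bundle XH AH"
proof (rule fell_bundle.intro[OF lc_groupoid_orbit_groupoid banach_bundle_orbit_bundle],
    rule fell_bundle_axioms.intro)
  note simps = orbit_bundle_simps orbit_groupoid_simps bmult_closed bstar_closed badd_closed bscale_closed
    proj_bmult proj_bstar proj_arrow bmult_assoc bmult_add_left bmult_add_right bmult_scale_left
    bmult_scale_right bstar_add bstar_scale bstar_bmult bstar_bstar
  have fib: "\<exists>b\<in>topspace (btop A). Q = tot.orb b \<and> proj A a = proj A b"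
    if "a \<in> topspace (btop A)" "Q \<in> topspace (btop AH)" "proj AH (tot.orb a) = proj AH Q" for a Q
    using fibre_lift[OF proj_arrow[OF that(1)] that(2)] that by (metis orbit_bundle_proj)
  have comp: "\<exists>a\<in>topspace (btop A). \<exists>b\<in>topspace (btop A).
      P = tot.orb a \<and> Q = tot.orb b \<and> bsrc X A a = brng X A b"
    if PQ: "P \<in> topspace (btop AH)" "Q \<in> topspace (btop AH)" "bsrc XH AH P = brng XH AH Q" for P Q
  proof -
    obtain a where a: "a \<in> topspace (btop A)" "P = tot.orb a" using PQ(1) by auto
    then show ?thesis using bundle_composable_lift[OF a(1) PQ(2)] PQ(3) by auto
  qed
  {
    fix P Q assume "P \<in> topspace (btop AH)" "Q \<in> topspace (btop AH)" "bsrc XH AH P = brng XH AH Q"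
    then obtain a b where ab: "a \<in> topspace (btop A)" "b \<in> topspace (btop A)"
      "P = tot.orb a" "Q = tot.orb b" "bsrc X A a = brng X A b" using comp by blast
    then have c: "src X (proj A a) = rng X (proj A b)" by (simp add: bsrc_def brng_def)
    show "bmult AH P Q \<in> topspace (btop AH)" using ab by (simp add: simps)
    show "proj AH (bmult AH P Q) = gmult XH (proj AH P) (proj AH Q)"
      using ab c by (simp add: simps)
    show "bmult AH (bscale AH c P) Q = bscale AH c (bmult AH P Q)" for c
      using ab by (simp add: simps bsrc_def)
    show "bmult AH P (bscale AH c Q) = bscale AH c (bmult AH P Q)" for c
      using ab by (simp add: simps brng_def)
    have "bsrc X A (bstar A b) = brng X A (bstar A a)"
      using ab c by (simp add: bsrc_def brng_def proj_bstar src_ginv rng_ginv proj_arrow)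
    then show "bstar AH (bmult AH P Q) = bmult AH (bstar AH Q) (bstar AH P)"
      using ab by (simp add: simps)
  next
    fix P Q R assume P: "P \<in> topspace (btop AH)" "Q \<in> topspace (btop AH)" "R \<in> topspace (btop AH)"
      "bsrc XH AH P = brng XH AH Q" "bsrc XH AH Q = brng XH AH R"
    then obtain a b where ab: "a \<in> topspace (btop A)" "b \<in> topspace (btop A)"
      "P = tot.orb a" "Q = tot.orb b" "bsrc X A a = brng X A b" using comp by blast
    moreover obtain d where d: "d \<in> topspace (btop A)" "R = tot.orb d" "bsrc X A b = brng X A d"
      using bundle_composable_lift[OF ab(2) P(3)] P(5) ab(4) by blast
    moreover have "bsrc X A (bmult A a b) = brng X A d" "bsrc X A a = brng X A (bmult A b d)"
      using ab d by (simp_all add: bsrc_def brng_def proj_bmult src_gmult rng_gmult proj_arrow)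
    ultimately show "bmult AH (bmult AH P Q) R = bmult AH P (bmult AH Q R)"
      by (simp add: simps)
  next
    fix P P' Q assume P: "P \<in> topspace (btop AH)" "P' \<in> topspace (btop AH)" "Q \<in> topspace (btop AH)"
      "proj AH P = proj AH P'" "bsrc XH AH P = brng XH AH Q"
    then obtain a b where ab: "a \<in> topspace (btop A)" "b \<in> topspace (btop A)"
      "P = tot.orb a" "Q = tot.orb b" "bsrc X A a = brng X A b" using comp by blast
    obtain a' where a': "a' \<in> topspace (btop A)" "P' = tot.orb a'" "proj A a = proj A a'"
      using fib[OF ab(1) P(2)] P(4) ab(3) by blast
    have c: "bsrc X A a' = brng X A b" "proj A (bmult A a b) = proj A (bmult A a' b)"
      using ab a' by (simp_all add: bsrc_def brng_def proj_bmult)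
    show "bmult AH (badd AH P P') Q = badd AH (bmult AH P Q) (bmult AH P' Q)"
      using ab a' c by (simp add: simps bsrc_def[of X A "badd A a a'"] bsrc_def[symmetric])
  next
    fix P Q Q' assume P: "P \<in> topspace (btop AH)" "Q \<in> topspace (btop AH)" "Q' \<in> topspace (btop AH)"
      "proj AH Q = proj AH Q'" "bsrc XH AH P = brng XH AH Q"
    then obtain a b where ab: "a \<in> topspace (btop A)" "b \<in> topspace (btop A)"
      "P = tot.orb a" "Q = tot.orb b" "bsrc X A a = brng X A b" using comp by blast
    obtain b' where b': "b' \<in> topspace (btop A)" "Q' = tot.orb b'" "proj A b = proj A b'"
      using fib[OF ab(2) P(3)] P(4) ab(4) by blast
    have c: "bsrc X A a = brng X A b'" "proj A (bmult A a b) = proj A (bmult A a b')"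
      using ab b' by (simp_all add: bsrc_def brng_def proj_bmult)
    show "bmult AH P (badd AH Q Q') = badd AH (bmult AH P Q) (bmult AH P Q')"
      using ab b' c by (simp add: simps brng_def[of X A "badd A b b'"] brng_def[symmetric])
  next
    fix P Q assume P: "P \<in> topspace (btop AH)" "Q \<in> topspace (btop AH)" "proj AH P = proj AH Q"
    then obtain a where a: "a \<in> topspace (btop A)" "P = tot.orb a" by auto
    obtain b where b: "b \<in> topspace (btop A)" "Q = tot.orb b" "proj A a = proj A b"
      using fib[OF a(1) P(2)] P(3) a(2) by blast
    show "bstar AH (badd AH P Q) = badd AH (bstar AH P) (bstar AH Q)"
      using a b by (simp add: simps)
  next
    fix P assume "P \<in> topspace (btop AH)"
    then obtain a where "a \<in> topspace (btop A)" "P = tot.orb a" by auto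
    then show "bstar AH P \<in> topspace (btop AH)" "proj AH (bstar AH P) = ginv XH (proj AH P)"
      "bstar AH (bscale AH c P) = bscale AH (cnj c) (bstar AH P)" "bstar AH (bstar AH P) = P" for c
      by (simp_all add: simps)
  }
  show "continuous_map (btop AH) (btop AH) (bstar AH)"
    unfolding btop_orbit
    by (rule continuous_map_orbit[OF tot.right_action_axioms tot.right_action_axioms continuous_bstar
          orbit_bundle_bstar])
  show "cstar_algebra (fibre_alg AH u)" if u: "u \<in> units XH" for u
  proof -
    obtain v where v: "v \<in> units X" "u = arr.orb v" using u by (auto simp: units_orbit)
    then show ?thesis
      using cstar_iso.cstar_algebra_iso[OF orbit_unit_fibre_iso cstar_fibre] by blast
  qed
qed (fact continuous_orbit_bmult orbit_imprimitivity)+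

end

theorem corollaryA8:
  fixes X :: "'x groupoid_data"
    and A :: "('a, 'x) fell_data"
    and H :: "'h monoid"
    and TH :: "'h topology"
    and act :: "'x \<Rightarrow> 'h \<Rightarrow> 'x"
    and bact :: "'a \<Rightarrow> 'h \<Rightarrow> 'a"
  assumes "lc_groupoid X"
    and "\<exists>l. left_haar_system X l"
    and "fell_bundle X A"
    and "lc_group H TH"
    and "fell_bundle_action X A H TH act bact"
    and "free_action (gtop X) H act"
    and "proper_action (gtop X) TH act"
  shows "fell_bundle (orbit_groupoid X H act) (orbit_bundle X A H bact) \<and>
    (\<forall>a \<in> topspace (btop A).
       proj (orbit_bundle X A H bact) (rorbit H bact a) = rorbit H act (proj A a)) \<and>
    (\<forall>a \<in> topspace (btop A). \<forall>b \<in> topspace (btop A). bsrc X A a = brng X A b \<longrightarrow>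
       bmult (orbit_bundle X A H bact) (rorbit H bact a) (rorbit H bact b)
         = rorbit H bact (bmult A a b)) \<and>
    (\<forall>a \<in> topspace (btop A).
       bstar (orbit_bundle X A H bact) (rorbit H bact a) = rorbit H bact (bstar A a))"
proof -
  interpret fell_bundle_action X A H TH act bact by fact
  interpret free_proper_bundle_action X A H TH act bact
    by unfold_locales fact+
  show ?thesis
    using fell_bundle_orbit_bundle orbit_bundle_proj orbit_bundle_bmult orbit_bundle_bstar by blast
qed

end
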